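(* Let $n$ be a positive integer, let $\mathcal{Y}^{\mathbf{a}}$ be the set of self-conjugate Young diagrams that fit inside an $n\times n$ box, and let $V$ be the (complex) vector space spanned by $\mathcal{Y}^{\mathbf{a}}$. Let $e_k$ and $f_k$ ($1\le k\le n$) act on $V$ by extending by linearity the operators $$\tilde e_k(Y)=Y^{--}_{k,2n-k},\quad \tilde f_k(Y)=Y^{++}_{k,2n-k}\quad(1\le k\le n-1),\qquad \tilde e_n(Y)=Y^-_n,\quad\tilde f_n(Y)=Y^+_n$$ (where the ghost partition $\nabla$ is identified with $0$), and define $h_k(Y)=\langle h_k,\mathrm{wt}(Y)\rangle Y$, extended by linearity, where $\mathrm{wt}(Y)=\omega_n-\sum_{i=1}^n\#\{\text{vertices in }Y\text{ of degree }i\}\,\alpha_i$. Then $V\cong V(\omega_n)$ as representations of $\mathfrak{so}_{2n+1}$, where $\{e_k,f_k,h_k\}_{k=1}^n$ are the usual Chevalley generators and $V(\omega_n)$ is the spin representation.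
   Context: $\mathfrak{so}_{2n+1}=\mathfrak{so}_{2n+1}(\mathbb{C})$ is the simple Lie algebra of type $B_n$, with simple roots $\alpha_1,\dots,\alpha_n$ ($\alpha_n$ the short one), coroots $h_1,\dots,h_n$ and fundamental weights $\omega_1,\dots,\omega_n$; thus $\langle h_{n-1},\alpha_n\rangle=-1$ and $\langle h_n,\alpha_{n-1}\rangle=-2$. $V(\omega_n)$ is the irreducible highest weight representation of highest weight $\omega_n$ (the spin representation). Let $\mathcal{Y}$ be the set of Young diagrams (partitions) $(n\ge\lambda_1\ge\lambda_2\ge\dots\ge\lambda_n\ge0)$ with at most $n$ rows and all rows of length at most $n$. A diagram is self-conjugate if it equals its reflection in the diagonal. Each box of $Y$ is called a vertex and has a degree in $\{1,\dots,2n-1\}$: the box in row $r$ and column $s$ has degree $n+s-r$ (boxes on the main diagonal have degree $n$; replacing this convention by $n+r-s$ makes no difference for self-conjugate diagrams). For $Y\in\mathcal{Y}$, $Y^+_k$ (resp. $Y^-_k$) is the Young diagram in $\mathcal{Y}$ obtained from $Y$ by adding (resp. removing) a vertex of degree $k$ if such a diagram exists, and is the ghost partition $\nabla$ otherwise. Similarly $Y^{++}_{i,j}$ (resp. $Y^{--}_{i,j}$) is the Young diagram in $\mathcal{Y}$ obtained from $Y$ by adding (resp. removing) a vertex of degree $i$ and a vertex of degree $j$ if it exists, and $\nabla$ otherwise. *)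

theory Defs
  imports "Jordan_Normal_Form.Matrix" "HOL-Library.Poly_Mapping"
begin

text \<open>
  The complex Lie algebra of type \<open>B\<^sub>n\<close> is realised as the Lie algebra of the nondegenerate
  symmetric bilinear form whose Gram matrix is antidiagonal. All nondegenerate symmetric forms over
  the complex numbers are equivalent; for this one the diagonal matrices form a Cartan subalgebra and
  the upper triangular matrices a Borel subalgebra. Rows and columns of matrices are numbered
  \<open>0, \<dots>, 2n\<close>.
\<close>

definition form_mat :: "nat \<Rightarrow> complex mat" where
  "form_mat n = mat (2*n+1) (2*n+1) (\<lambda>(i,j). if i + j = 2*n then 1 else 0)"

definition so_odd :: "nat \<Rightarrow> complex mat set" where
  "so_odd n = {X \<in> carrier_mat (2*n+1) (2*n+1).
     transpose_mat X * form_mat n + form_mat n * X = 0\<^sub>m (2*n+1) (2*n+1)}"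

definition lie_bracket :: "complex mat \<Rightarrow> complex mat \<Rightarrow> complex mat" where
  "lie_bracket X Y = X * Y - Y * X"

definition cartan :: "nat \<Rightarrow> complex mat set" where
  "cartan n = {H \<in> so_odd n. diagonal_mat H}"

text \<open>Weights are linear functionals on the Cartan subalgebra; \<open>\<epsilon>\<^sub>i\<close> (for \<open>1 \<le> i \<le> n\<close>) reads off
  the \<open>i\<close>-th diagonal entry. The simple roots are
  \<open>\<alpha>\<^sub>k = \<epsilon>\<^sub>k - \<epsilon>\<^bsub>k+1\<^esub>\<close> for \<open>k < n\<close> and the short root \<open>\<alpha>\<^sub>n = \<epsilon>\<^sub>n\<close>.\<close>

definition eps :: "nat \<Rightarrow> complex mat \<Rightarrow> complex" where
  "eps i H = H $$ (i-1, i-1)"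

definition simple_root :: "nat \<Rightarrow> nat \<Rightarrow> complex mat \<Rightarrow> complex" where
  "simple_root n k H = (if k < n then eps k H - eps (k+1) H else eps n H)"

definition fund_weight :: "nat \<Rightarrow> nat \<Rightarrow> complex mat \<Rightarrow> complex" where
  "fund_weight n i H = (if i < n then (\<Sum>j=1..i. eps j H) else (\<Sum>j=1..n. eps j H) / 2)"

definition elem_mat :: "nat \<Rightarrow> nat \<Rightarrow> nat \<Rightarrow> complex mat" where
  "elem_mat n i j = mat (2*n+1) (2*n+1) (\<lambda>(a,b). if a = i \<and> b = j then 1 else 0)"

text \<open>Chevalley generators, for \<open>1 \<le> k \<le> n\<close>. The factor 2 for \<open>k = n\<close> comes from
  \<open>\<alpha>\<^sub>n\<close> being short, with coroot \<open>2\<epsilon>\<^sub>n\<close>.\<close>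

definition chev_e :: "nat \<Rightarrow> nat \<Rightarrow> complex mat" where
  "chev_e n k = elem_mat n (k-1) k - elem_mat n (2*n-k) (2*n-k+1)"

definition chev_f :: "nat \<Rightarrow> nat \<Rightarrow> complex mat" where
  "chev_f n k = (if k = n then 2 else 1) \<cdot>\<^sub>m
     (elem_mat n k (k-1) - elem_mat n (2*n-k+1) (2*n-k))"

definition chev_h :: "nat \<Rightarrow> nat \<Rightarrow> complex mat" where
  "chev_h n k = (if k = n then 2 else 1) \<cdot>\<^sub>m
     (elem_mat n (k-1) (k-1) - elem_mat n k k
       + elem_mat n (2*n-k) (2*n-k) - elem_mat n (2*n-k+1) (2*n-k+1))"

text \<open>A representation lives on a subspace \<open>V\<close> of an ambient complex vector space whose scalar
  multiplication is \<open>scl\<close>; \<open>\<rho> X v\<close> is meaningful for \<open>X \<in> so_odd n\<close> and \<open>v \<in> V\<close> only.\<close>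

definition so_rep ::
  "nat \<Rightarrow> (complex \<Rightarrow> 'v::ab_group_add \<Rightarrow> 'v) \<Rightarrow> 'v set \<Rightarrow> (complex mat \<Rightarrow> 'v \<Rightarrow> 'v) \<Rightarrow> bool" where
  "so_rep n scl V \<rho> \<longleftrightarrow>
     vector_space scl \<and> module.subspace scl V \<and>
     (\<forall>X\<in>so_odd n. \<forall>v\<in>V. \<rho> X v \<in> V) \<and>
     (\<forall>X\<in>so_odd n. \<forall>v\<in>V. \<forall>w\<in>V. \<rho> X (v + w) = \<rho> X v + \<rho> X w) \<and>
     (\<forall>X\<in>so_odd n. \<forall>c. \<forall>v\<in>V. \<rho> X (scl c v) = scl c (\<rho> X v)) \<and>
     (\<forall>X\<in>so_odd n. \<forall>Y\<in>so_odd n. \<forall>v\<in>V. \<rho> (X + Y) v = \<rho> X v + \<rho> Y v) \<and>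
     (\<forall>X\<in>so_odd n. \<forall>c. \<forall>v\<in>V. \<rho> (c \<cdot>\<^sub>m X) v = scl c (\<rho> X v)) \<and>
     (\<forall>X\<in>so_odd n. \<forall>Y\<in>so_odd n. \<forall>v\<in>V.
        \<rho> (lie_bracket X Y) v = \<rho> X (\<rho> Y v) - \<rho> Y (\<rho> X v))"

definition invariant_subspace ::
  "nat \<Rightarrow> (complex \<Rightarrow> 'v::ab_group_add \<Rightarrow> 'v) \<Rightarrow> 'v set \<Rightarrow> (complex mat \<Rightarrow> 'v \<Rightarrow> 'v) \<Rightarrow> 'v set \<Rightarrow> bool"
where
  "invariant_subspace n scl V \<rho> U \<longleftrightarrow>
     U \<subseteq> V \<and> module.subspace scl U \<and> (\<forall>X\<in>so_odd n. \<forall>u\<in>U. \<rho> X u \<in> U)"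

definition irreducible_rep ::
  "nat \<Rightarrow> (complex \<Rightarrow> 'v::ab_group_add \<Rightarrow> 'v) \<Rightarrow> 'v set \<Rightarrow> (complex mat \<Rightarrow> 'v \<Rightarrow> 'v) \<Rightarrow> bool" where
  "irreducible_rep n scl V \<rho> \<longleftrightarrow> so_rep n scl V \<rho> \<and> V \<noteq> {0} \<and>
     (\<forall>U. invariant_subspace n scl V \<rho> U \<longrightarrow> U = {0} \<or> U = V)"

definition highest_weight_rep ::
  "nat \<Rightarrow> (complex mat \<Rightarrow> complex) \<Rightarrow> (complex \<Rightarrow> 'v::ab_group_add \<Rightarrow> 'v) \<Rightarrow> 'v set
     \<Rightarrow> (complex mat \<Rightarrow> 'v \<Rightarrow> 'v) \<Rightarrow> bool" where
  "highest_weight_rep n \<mu> scl V \<rho> \<longleftrightarrow> so_rep n scl V \<rho> \<and>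
     (\<exists>v\<in>V. v \<noteq> 0 \<and>
        (\<forall>k\<in>{1..n}. \<rho> (chev_e n k) v = 0) \<and>
        (\<forall>H\<in>cartan n. \<rho> H v = scl (\<mu> H) v) \<and>
        (\<forall>U. invariant_subspace n scl V \<rho> U \<and> v \<in> U \<longrightarrow> U = V))"

text \<open>\<open>V(\<mu>)\<close> is determined only up to isomorphism, hence the predicate ``is a model of
  \<open>V(\<mu>)\<close>''.\<close>

definition is_irreducible_hw_rep ::
  "nat \<Rightarrow> (complex mat \<Rightarrow> complex) \<Rightarrow> (complex \<Rightarrow> 'v::ab_group_add \<Rightarrow> 'v) \<Rightarrow> 'v set
     \<Rightarrow> (complex mat \<Rightarrow> 'v \<Rightarrow> 'v) \<Rightarrow> bool" where
  "is_irreducible_hw_rep n \<mu> scl V \<rho> \<longleftrightarrow>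
     irreducible_rep n scl V \<rho> \<and> highest_weight_rep n \<mu> scl V \<rho>"

definition rep_isomorphic ::
  "nat \<Rightarrow> (complex \<Rightarrow> 'v::ab_group_add \<Rightarrow> 'v) \<Rightarrow> 'v set \<Rightarrow> (complex mat \<Rightarrow> 'v \<Rightarrow> 'v)
     \<Rightarrow> (complex \<Rightarrow> 'w::ab_group_add \<Rightarrow> 'w) \<Rightarrow> 'w set \<Rightarrow> (complex mat \<Rightarrow> 'w \<Rightarrow> 'w) \<Rightarrow> bool" where
  "rep_isomorphic n sclV V \<rho> sclW W \<sigma> \<longleftrightarrow>
     (\<exists>\<phi>. bij_betw \<phi> V W \<and>
        (\<forall>v\<in>V. \<forall>w\<in>V. \<phi> (v + w) = \<phi> v + \<phi> w) \<and>
        (\<forall>c. \<forall>v\<in>V. \<phi> (sclV c v) = sclW c (\<phi> v)) \<and>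
        (\<forall>X\<in>so_odd n. \<forall>v\<in>V. \<phi> (\<rho> X v) = \<sigma> X (\<phi> v)))"

type_synonym diagram = "(nat \<times> nat) set"

text \<open>A diagram is its set of boxes (row, column), both numbered from 1.\<close>

definition young :: "nat \<Rightarrow> diagram set" where
  "young n = {{(r,s). r \<in> {1..n} \<and> s \<in> {1..p r}} | p.
     (\<forall>r\<in>{1..n}. p r \<le> n) \<and> (\<forall>r\<in>{1..n}. \<forall>r'\<in>{1..n}. r \<le> r' \<longrightarrow> p r' \<le> p r)}"

definition sc_young :: "nat \<Rightarrow> diagram set" where
  "sc_young n = {Y \<in> young n. Y\<inverse> = Y}"

text \<open>Only used for boxes of the square, so that the subtraction does not truncate.\<close>

definition box_degree :: "nat \<Rightarrow> nat \<times> nat \<Rightarrow> nat" where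
  "box_degree n b = n + snd b - fst b"

definition adds_to :: "nat \<Rightarrow> nat \<Rightarrow> diagram \<Rightarrow> diagram \<Rightarrow> bool" where
  "adds_to n k Y Y' \<longleftrightarrow> Y \<in> young n \<and> Y' \<in> young n \<and>
     (\<exists>b. b \<notin> Y \<and> box_degree n b = k \<and> Y' = insert b Y)"

definition adds2_to :: "nat \<Rightarrow> nat \<Rightarrow> nat \<Rightarrow> diagram \<Rightarrow> diagram \<Rightarrow> bool" where
  "adds2_to n i j Y Y' \<longleftrightarrow> Y \<in> young n \<and> Y' \<in> young n \<and>
     (\<exists>b c. b \<notin> Y \<and> c \<notin> Y \<and> b \<noteq> c \<and> box_degree n b = i \<and> box_degree n c = j \<and> Y' = Y \<union> {b, c})"

text \<open>The ghost partition is \<^const>\<open>None\<close>.\<close>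

definition the_or_ghost :: "(diagram \<Rightarrow> bool) \<Rightarrow> diagram option" where
  "the_or_ghost P = (if \<exists>Y. P Y then Some (THE Y. P Y) else None)"

definition add_vertex :: "nat \<Rightarrow> nat \<Rightarrow> diagram \<Rightarrow> diagram option" where
  "add_vertex n k Y = the_or_ghost (\<lambda>Y'. adds_to n k Y Y')"

definition remove_vertex :: "nat \<Rightarrow> nat \<Rightarrow> diagram \<Rightarrow> diagram option" where
  "remove_vertex n k Y = the_or_ghost (\<lambda>Y'. adds_to n k Y' Y)"

definition add_vertices :: "nat \<Rightarrow> nat \<Rightarrow> nat \<Rightarrow> diagram \<Rightarrow> diagram option" where
  "add_vertices n i j Y = the_or_ghost (\<lambda>Y'. adds2_to n i j Y Y')"

definition remove_vertices :: "nat \<Rightarrow> nat \<Rightarrow> nat \<Rightarrow> diagram \<Rightarrow> diagram option" where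
  "remove_vertices n i j Y = the_or_ghost (\<lambda>Y'. adds2_to n i j Y' Y)"

definition e_tilde :: "nat \<Rightarrow> nat \<Rightarrow> diagram \<Rightarrow> diagram option" where
  "e_tilde n k Y = (if k = n then remove_vertex n n Y else remove_vertices n k (2*n-k) Y)"

definition f_tilde :: "nat \<Rightarrow> nat \<Rightarrow> diagram \<Rightarrow> diagram option" where
  "f_tilde n k Y = (if k = n then add_vertex n n Y else add_vertices n k (2*n-k) Y)"

definition wt :: "nat \<Rightarrow> diagram \<Rightarrow> complex mat \<Rightarrow> complex" where
  "wt n Y H = fund_weight n n H -
     (\<Sum>i=1..n. of_nat (card {b \<in> Y. box_degree n b = i}) * simple_root n i H)"

text \<open>The free complex vector space on all diagrams consists of the finitely supported functions
  \<open>diagram \<Rightarrow>\<^sub>0 complex\<close>.\<close>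

definition fscale :: "complex \<Rightarrow> ('a \<Rightarrow>\<^sub>0 complex) \<Rightarrow> ('a \<Rightarrow>\<^sub>0 complex)" where
  "fscale c v = Poly_Mapping.map (\<lambda>x. c * x) v"

lemma lookup_fscale [simp]: "Poly_Mapping.lookup (fscale c v) a = c * Poly_Mapping.lookup v a"
  by (simp add: fscale_def Poly_Mapping.map.rep_eq Poly_Mapping.when_def)

lemma vector_space_fscale: "vector_space fscale"
  by unfold_locales (auto intro!: poly_mapping_eqI simp: Poly_Mapping.lookup_add algebra_simps)

definition basis_vec :: "'a \<Rightarrow> ('a \<Rightarrow>\<^sub>0 complex)" where
  "basis_vec a = Poly_Mapping.single a 1"

definition vec_of :: "'a option \<Rightarrow> ('a \<Rightarrow>\<^sub>0 complex)" where
  "vec_of = case_option 0 basis_vec"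

definition lin_ext :: "('a \<Rightarrow> ('a \<Rightarrow>\<^sub>0 complex)) \<Rightarrow> ('a \<Rightarrow>\<^sub>0 complex) \<Rightarrow> ('a \<Rightarrow>\<^sub>0 complex)" where
  "lin_ext g v = (\<Sum>a\<in>Poly_Mapping.keys v. fscale (Poly_Mapping.lookup v a) (g a))"

definition sc_space :: "nat \<Rightarrow> (diagram \<Rightarrow>\<^sub>0 complex) set" where
  "sc_space n = module.span fscale (basis_vec ` sc_young n)"

definition op_e :: "nat \<Rightarrow> nat \<Rightarrow> (diagram \<Rightarrow>\<^sub>0 complex) \<Rightarrow> (diagram \<Rightarrow>\<^sub>0 complex)" where
  "op_e n k = lin_ext (\<lambda>Y. vec_of (e_tilde n k Y))"

definition op_f :: "nat \<Rightarrow> nat \<Rightarrow> (diagram \<Rightarrow>\<^sub>0 complex) \<Rightarrow> (diagram \<Rightarrow>\<^sub>0 complex)" where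
  "op_f n k = lin_ext (\<lambda>Y. vec_of (f_tilde n k Y))"

definition op_h :: "nat \<Rightarrow> nat \<Rightarrow> (diagram \<Rightarrow>\<^sub>0 complex) \<Rightarrow> (diagram \<Rightarrow>\<^sub>0 complex)" where
  "op_h n k = lin_ext (\<lambda>Y. fscale (wt n Y (chev_h n k)) (basis_vec Y))"

lemma eps_chev_h:
  assumes "j \<in> {1..n}" "k \<in> {1..n}"
  shows "eps j (chev_h n k) =
    (if k = n then 2 else 1) * ((if j = k then 1 else 0) - (if j = k + 1 then 1 else 0))"
proof -
  have idx: "j - 1 < 2*n+1" "(j - 1 = k - 1) = (j = k)" "(j - 1 = k) = (j = k + 1)"
    "j - 1 \<noteq> 2*n-k" "j - 1 \<noteq> 2*n-k+1"
    using assms unfolding atLeastAtMost_iff by linarith+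
  have dims: "dim_row (elem_mat n a b) = 2*n+1" "dim_col (elem_mat n a b) = 2*n+1" for a b
    by (simp_all add: elem_mat_def)
  have entry: "elem_mat n a b $$ (j-1, j-1) = (if j - 1 = a \<and> j - 1 = b then 1 else 0)" for a b
    unfolding elem_mat_def index_mat(1)[OF idx(1) idx(1)] by (simp only: prod.case)
  show ?thesis
    unfolding eps_def chev_h_def
    by (simp only: index_smult_mat index_add_mat index_minus_mat dims entry idx
        HOL.simp_thms if_False add_0_right diff_zero)
qed

lemma simple_root_chev_h:
  assumes "i \<in> {1..n}" "k \<in> {1..n}"
  shows "simple_root n i (chev_h n k) =
    (if i = k then 2 else if i = k + 1 then -1
     else if k = i + 1 then (if k = n then -2 else -1) else 0)"
proof (cases "i < n")
  case True
  have i1: "i + 1 \<in> {1..n}"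
    using True by simp
  consider "i = k" | "i = k + 1" | "k = i + 1" | "i \<noteq> k" "i \<noteq> k + 1" "k \<noteq> i + 1"
    by blast
  then show ?thesis
    unfolding simple_root_def eps_chev_h[OF assms] eps_chev_h[OF i1 assms(2)] if_P[OF True]
    using True by cases simp_all
next
  case False
  then have n: "i = n" "n \<in> {1..n}"
    using assms by simp_all
  consider "k = n" | "n = k + 1" | "k \<noteq> n" "n \<noteq> k + 1" "k \<noteq> n + 1"
    using assms(2) by fastforce
  then show ?thesis
    unfolding simple_root_def eps_chev_h[OF n(2) assms(2)] if_not_P[OF False] n(1)
    by cases simp_all
qed

lemma fund_weight_chev_h:
  assumes "i \<in> {1..n}" "k \<in> {1..n}"
  shows "fund_weight n i (chev_h n k) = (if i = k then 1 else 0)"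
proof -
  define c :: complex where "c = (if k = n then 2 else 1)"
  have S: "(\<Sum>j=1..m. eps j (chev_h n k)) = (if m = k then c else 0)" if "m \<le> n" for m
    using that
  proof (induction m)
    case 0
    then show ?case
      using assms(2) by simp
  next
    case (Suc m)
    have IH: "(\<Sum>j=1..m. eps j (chev_h n k)) = (if m = k then c else 0)"
      by (rule Suc.IH) (use Suc.prems in linarith)
    have le: "\<not> Suc m < 1" "Suc m \<in> {1..n}"
      using Suc.prems by simp_all
    have "(\<Sum>j=1..Suc m. eps j (chev_h n k)) = (if m = k then c else 0) + eps (Suc m) (chev_h n k)"
      by (simp only: sum.cl_ivl_Suc le IH if_False)
    also have "\<dots> = (if m = k then c else 0)
        + c * ((if Suc m = k then 1 else 0) - (if m = k then 1 else 0))"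
      unfolding eps_chev_h[OF le(2) assms(2)] c_def by (simp only: Suc_eq_plus1 add_right_cancel)
    also have "\<dots> = (if Suc m = k then c else 0)"
    proof (cases "m = k")
      case True
      then have "Suc m \<noteq> k" by simp
      then show ?thesis using True by simp
    next
      case False
      then show ?thesis by (cases "Suc m = k") simp_all
    qed
    finally show ?case .
  qed
  show ?thesis
  proof (cases "i < n")
    case True
    then show ?thesis
      using S[of i] by (cases "i = k") (simp_all add: fund_weight_def c_def)
  next
    case False
    then have "i = n"
      using assms(1) by simp
    then show ?thesis
      using S[of n] by (cases "n = k") (simp_all add: fund_weight_def c_def)
  qed
qed

end

theory Submission
  imports Defs "HOL-Library.Product_Plus" "HOL-Library.Nat_Bijection"
begin

text \<open>Self-conjugate diagrams in the \<open>n \<times> n\<close> square correspond to subsets \<open>S\<close> of \<open>{0, \<dots>, n-1}\<close>: the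
  boxes of a given degree form an initial segment of a diagonal, the lengths of the diagonals of degree
  \<open>1, \<dots>, n\<close> determine the diagram, and they increase by 0 or 1 from one degree to the next; \<open>S\<close> records
  where they increase (\<open>sc_diagram_surj\<close>, \<open>sc_diagram_inj\<close>). In these terms the weight of a diagram is
  \<open>(\<plusminus>\<epsilon>\<^sub>1 \<plusminus> \<dots> \<plusminus> \<epsilon>\<^sub>n) / 2\<close> with the minus signs given by \<open>S\<close> (\<open>wt_sc_diagram\<close>), the operator
  \<open>f\<^sub>k\<close> replaces \<open>k\<close> by \<open>k - 1\<close> in \<open>S\<close>, and \<open>f\<^sub>n\<close> inserts \<open>n - 1\<close> (\<open>f_tilde_sc_diagram\<close>,
  \<open>e_tilde_sc_diagram\<close>).

  This is the fermionic Fock space. Annihilation and creation operators on it, together with the parity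
  operator, satisfy Clifford relations (\<open>gamma_anticommute\<close>), and quadratic expressions in operators with
  these relations represent the orthogonal Lie algebra (\<open>so_rep_act\<close>). Thus the action exists on the
  whole Lie algebra without a presentation by generators and relations. It remains to compare it with the
  given operators on the basis, where a suitable sign convention makes all signs cancel (\<open>spin_rep_chevalley\<close>).

  All weights have multiplicity one, and root vectors for short roots insert or remove single elements,
  so the representation is irreducible, with the empty diagram as highest weight vector
  (\<open>spin_rep_is_irreducible_hw_rep\<close>).

  An arbitrary model of \<open>V(\<omega>\<^sub>n)\<close> is isomorphic to it by the usual uniqueness argument
  (\<open>irreducible_hw_rep_unique\<close>): in the direct sum of two models, the pair of highest weight vectors
  generates the graph of an isomorphism. This rests on a description of the subrepresentation that a
  highest weight vector generates (\<open>highest_weight_submodule\<close>), and hence on the Chevalley generators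
  generating the Lie algebra (\<open>so_odd_generated\<close>).\<close>

section \<open>The matrices of the orthogonal Lie algebra\<close>

lemma in_so_odd_iff:
  "X \<in> so_odd n \<longleftrightarrow> X \<in> carrier_mat (2*n+1) (2*n+1) \<and>
     (\<forall>i\<le>2*n. \<forall>j\<le>2*n. X $$ (2*n-j, 2*n-i) = - X $$ (i, j))"
proof (cases "X \<in> carrier_mat (2*n+1) (2*n+1)")
  case True
  have entry: "(transpose_mat X * form_mat n + form_mat n * X) $$ (i,j)
      = X $$ (2*n-j, i) + X $$ (2*n-i, j)" if "i < 2*n+1" "j < 2*n+1" for i j
  proof -
    have e1: "(if l + j = 2*n then 1 else 0) = (if l = 2*n - j then 1 else (0::complex))" for l
      using that by auto
    have e2: "(if i + l = 2*n then 1 else 0) = (if l = 2*n - i then 1 else (0::complex))" for l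
      using that by auto
    have "(transpose_mat X * form_mat n) $$ (i,j)
        = (\<Sum>l\<in>{0..<2*n+1}. X $$ (l, i) * (if l + j = 2*n then 1 else 0))"
      using that True by (simp add: scalar_prod_def form_mat_def)
    also have "\<dots> = X $$ (2*n-j, i)"
      unfolding e1 by (simp add: if_distrib cong: if_cong)
    finally have 1: "(transpose_mat X * form_mat n) $$ (i,j) = X $$ (2*n-j, i)" .
    have "(form_mat n * X) $$ (i,j)
        = (\<Sum>l\<in>{0..<2*n+1}. (if i + l = 2*n then 1 else 0) * X $$ (l, j))"
      using that True by (simp add: scalar_prod_def form_mat_def)
    also have "\<dots> = X $$ (2*n-i, j)"
      unfolding e2 by (simp add: if_distrib[of "\<lambda>x. x * _"] cong: if_cong)
    finally have 2: "(form_mat n * X) $$ (i,j) = X $$ (2*n-i, j)" .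
    show ?thesis using that True 1 2 by (simp add: form_mat_def)
  qed
  have "X \<in> so_odd n \<longleftrightarrow> (\<forall>i<2*n+1. \<forall>j<2*n+1. X $$ (2*n-j, i) + X $$ (2*n-i, j) = 0)"
  proof -
    have "X \<in> so_odd n \<longleftrightarrow>
        transpose_mat X * form_mat n + form_mat n * X = 0\<^sub>m (2*n+1) (2*n+1)"
      using True by (simp add: so_odd_def)
    also have "\<dots> \<longleftrightarrow> (\<forall>i<2*n+1. \<forall>j<2*n+1.
        (transpose_mat X * form_mat n + form_mat n * X) $$ (i,j) = 0)"
      using True by (auto simp: form_mat_def mat_eq_iff)
    finally show ?thesis using entry by simp
  qed
  also have "\<dots> \<longleftrightarrow> (\<forall>i\<le>2*n. \<forall>j\<le>2*n. X $$ (2*n-j, 2*n-i) = - X $$ (i, j))"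
  proof (intro iffI allI impI)
    fix i j assume *: "\<forall>i<2*n+1. \<forall>j<2*n+1. X $$ (2*n-j, i) + X $$ (2*n-i, j) = 0"
      and "i \<le> 2*n" "j \<le> 2*n"
    then show "X $$ (2*n-j, 2*n-i) = - X $$ (i, j)"
      using *[rule_format, of "2*n-i" j] by (simp add: eq_neg_iff_add_eq_0)
  next
    fix i j assume *: "\<forall>i\<le>2*n. \<forall>j\<le>2*n. X $$ (2*n-j, 2*n-i) = - X $$ (i, j)"
      and "i < 2*n+1" "j < 2*n+1"
    then show "X $$ (2*n-j, i) + X $$ (2*n-i, j) = 0"
      using *[rule_format, of "2*n-i" j] by simp
  qed
  finally show ?thesis using True by simp
qed (simp add: so_odd_def)

lemma so_odd_carrier: "X \<in> so_odd n \<Longrightarrow> X \<in> carrier_mat (2*n+1) (2*n+1)"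
  by (simp add: so_odd_def)

lemma so_odd_dim [simp]:
  "X \<in> so_odd n \<Longrightarrow> dim_row X = 2*n+1" "X \<in> so_odd n \<Longrightarrow> dim_col X = 2*n+1"
  by (auto simp: so_odd_def)

lemma so_odd_entry:
  "X \<in> so_odd n \<Longrightarrow> i \<le> 2*n \<Longrightarrow> j \<le> 2*n \<Longrightarrow> X $$ (2*n-j, 2*n-i) = - X $$ (i, j)"
  by (simp add: in_so_odd_iff)

lemma add_in_so_odd: "X \<in> so_odd n \<Longrightarrow> Y \<in> so_odd n \<Longrightarrow> X + Y \<in> so_odd n"
  by (auto simp: in_so_odd_iff)

lemma smult_in_so_odd: "X \<in> so_odd n \<Longrightarrow> c \<cdot>\<^sub>m X \<in> so_odd n"
  by (auto simp: in_so_odd_iff)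

lemma lie_bracket_entry:
  assumes "X \<in> so_odd n" "Y \<in> so_odd n" "i \<le> 2*n" "j \<le> 2*n"
  shows "lie_bracket X Y $$ (i,j) =
    (\<Sum>l\<le>2*n. X $$ (i,l) * Y $$ (l,j)) - (\<Sum>l\<le>2*n. Y $$ (i,l) * X $$ (l,j))"
proof -
  have "{0..<2*n+1} = {..2*n}" by auto
  then show ?thesis
    using assms by (simp add: lie_bracket_def scalar_prod_def)
qed

lemma lie_bracket_in_so_odd:
  assumes X: "X \<in> so_odd n" and Y: "Y \<in> so_odd n"
  shows "lie_bracket X Y \<in> so_odd n"
  unfolding in_so_odd_iff
proof (intro conjI allI impI)
  show "lie_bracket X Y \<in> carrier_mat (2*n+1) (2*n+1)"
    using so_odd_carrier[OF X] so_odd_carrier[OF Y] by (auto simp: lie_bracket_def intro!: minus_carrier_mat)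
next
  fix i j assume ij: "i \<le> 2*n" "j \<le> 2*n"
  \<comment> \<open>The defining symmetry turns a product into the product in the opposite order.\<close>
  have flip: "(\<Sum>l\<le>2*n. X $$ (2*n-j,l) * Y $$ (l,2*n-i)) = (\<Sum>l\<le>2*n. Y $$ (i,l) * X $$ (l,j))"
    if X: "X \<in> so_odd n" and Y: "Y \<in> so_odd n" for X Y
  proof -
    have "(\<Sum>l\<le>2*n. X $$ (2*n-j,l) * Y $$ (l,2*n-i))
        = (\<Sum>l\<le>2*n. X $$ (2*n-j,2*n-l) * Y $$ (2*n-l,2*n-i))"
      by (rule sum.nat_diff_reindex[symmetric, where n="Suc (2*n)", simplified lessThan_Suc_atMost, simplified])
    also have "\<dots> = (\<Sum>l\<le>2*n. Y $$ (i,l) * X $$ (l,j))"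
      by (rule sum.cong) (use ij in \<open>simp_all add: so_odd_entry[OF X] so_odd_entry[OF Y]\<close>)
    finally show ?thesis .
  qed
  show "lie_bracket X Y $$ (2*n-j, 2*n-i) = - lie_bracket X Y $$ (i,j)"
    using ij by (simp add: lie_bracket_entry[OF X Y] flip[OF X Y] flip[OF Y X])
qed

text \<open>Write \<open>i'\<close> for \<open>2n - i\<close> and \<open>E(i,j)\<close> for the matrix units. The matrices
  \<open>E(i,j) - E(j',i')\<close> span the Lie algebra: the nonzero ones off the diagonal are root vectors, those
  on the diagonal span the Cartan subalgebra, and the Chevalley generators \<open>e\<^sub>k\<close> and \<open>f\<^sub>k\<close> are
  the ones next to the diagonal, up to a factor.\<close>

definition root_mat :: "nat \<Rightarrow> nat \<Rightarrow> nat \<Rightarrow> complex mat" where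
  "root_mat n i j = elem_mat n i j - elem_mat n (2*n-j) (2*n-i)"

lemma elem_mat_entry [simp]:
  "a \<le> 2*n \<Longrightarrow> b \<le> 2*n \<Longrightarrow> elem_mat n i j $$ (a,b) = (if a = i \<and> b = j then 1 else 0)"
  by (simp add: elem_mat_def)

lemma elem_mat_dim [simp]: "dim_row (elem_mat n i j) = 2*n+1" "dim_col (elem_mat n i j) = 2*n+1"
  by (simp_all add: elem_mat_def)

lemma root_mat_dim [simp]: "dim_row (root_mat n i j) = 2*n+1" "dim_col (root_mat n i j) = 2*n+1"
  by (simp_all add: root_mat_def)

lemma root_mat_entry:
  "a \<le> 2*n \<Longrightarrow> b \<le> 2*n \<Longrightarrow> root_mat n i j $$ (a,b) =
     (if a = i \<and> b = j then 1 else 0) - (if a = 2*n-j \<and> b = 2*n-i then 1 else 0)"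
  by (simp add: root_mat_def)

lemma root_mat_in_so_odd:
  assumes "i \<le> 2*n" "j \<le> 2*n"
  shows "root_mat n i j \<in> so_odd n"
proof -
  have "root_mat n i j $$ (2*n-b, 2*n-a) = - root_mat n i j $$ (a, b)"
    if "a \<le> 2*n" "b \<le> 2*n" for a b
  proof -
    have "2*n-b = i \<and> 2*n-a = j \<longleftrightarrow> a = 2*n-j \<and> b = 2*n-i"
      "2*n-b = 2*n-j \<and> 2*n-a = 2*n-i \<longleftrightarrow> a = i \<and> b = j"
      using that assms by auto
    then show ?thesis
      by (simp only: root_mat_entry[OF that] root_mat_entry[OF diff_le_self diff_le_self])
         (simp only: minus_diff_eq)
  qed
  then show ?thesis
    by (auto simp: in_so_odd_iff intro!: carrier_matI)
qed

lemma chev_e_eq: "k \<in> {1..n} \<Longrightarrow> chev_e n k = root_mat n (k-1) k"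
  by (auto simp: chev_e_def root_mat_def intro!: arg_cong2[where f="(-)"] arg_cong2[where f="elem_mat n"])

lemma chev_f_eq: "k \<in> {1..n} \<Longrightarrow> chev_f n k = (if k = n then 2 else 1) \<cdot>\<^sub>m root_mat n k (k-1)"
proof -
  assume "k \<in> {1..n}"
  then have "2*n - (k-1) = 2*n-k+1" by auto
  then show ?thesis by (simp add: chev_f_def root_mat_def)
qed

lemma chev_in_so_odd:
  assumes "k \<in> {1..n}"
  shows "chev_e n k \<in> so_odd n" "chev_f n k \<in> so_odd n"
  using assms
  by (auto simp: chev_e_eq chev_f_eq intro!: root_mat_in_so_odd smult_in_so_odd)

lemma cartan_so_odd: "H \<in> cartan n \<Longrightarrow> H \<in> so_odd n"
  by (simp add: cartan_def)

lemma cartanI: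
  "H \<in> so_odd n \<Longrightarrow> (\<And>a b. a \<le> 2*n \<Longrightarrow> b \<le> 2*n \<Longrightarrow> a \<noteq> b \<Longrightarrow> H $$ (a,b) = 0) \<Longrightarrow> H \<in> cartan n"
  by (auto simp: cartan_def diagonal_mat_def)

lemma cartan_off_diagonal:
  "H \<in> cartan n \<Longrightarrow> a \<le> 2*n \<Longrightarrow> b \<le> 2*n \<Longrightarrow> a \<noteq> b \<Longrightarrow> H $$ (a,b) = 0"
  by (auto simp: cartan_def diagonal_mat_def)

lemma root_mat_diag_cartan: "i \<le> 2*n \<Longrightarrow> root_mat n i i \<in> cartan n"
  by (rule cartanI) (auto simp: root_mat_in_so_odd root_mat_entry)

lemma lie_bracket_root_mat_entry:
  assumes "i \<le> 2*n" "j \<le> 2*n" "X \<in> so_odd n" "a \<le> 2*n" "b \<le> 2*n"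
  shows "lie_bracket (root_mat n i j) X $$ (a,b) =
    (if a = i then X $$ (j,b) else 0) - (if a = 2*n-j then X $$ (2*n-i,b) else 0)
    - (if b = j then X $$ (a,i) else 0) + (if b = 2*n-i then X $$ (a,2*n-j) else 0)"
proof -
  have 1: "(\<Sum>l\<le>2*n. root_mat n i j $$ (a,l) * X $$ (l,b)) =
      (if a = i then X $$ (j,b) else 0) - (if a = 2*n-j then X $$ (2*n-i,b) else 0)"
  proof -
    have "(\<Sum>l\<le>2*n. root_mat n i j $$ (a,l) * X $$ (l,b)) =
       (\<Sum>l\<le>2*n. (if l = j then if a = i then X $$ (l,b) else 0 else 0)
         - (if l = 2*n-i then if a = 2*n-j then X $$ (l,b) else 0 else 0))"
      by (rule sum.cong) (use assms in \<open>auto simp: root_mat_entry\<close>)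
    then show ?thesis using assms by (simp add: sum_subtractf)
  qed
  have 2: "(\<Sum>l\<le>2*n. X $$ (a,l) * root_mat n i j $$ (l,b)) =
      (if b = j then X $$ (a,i) else 0) - (if b = 2*n-i then X $$ (a,2*n-j) else 0)"
  proof -
    have "(\<Sum>l\<le>2*n. X $$ (a,l) * root_mat n i j $$ (l,b)) =
       (\<Sum>l\<le>2*n. (if l = i then if b = j then X $$ (a,l) else 0 else 0)
         - (if l = 2*n-j then if b = 2*n-i then X $$ (a,l) else 0 else 0))"
      by (rule sum.cong) (use assms in \<open>auto simp: root_mat_entry\<close>)
    then show ?thesis using assms by (simp add: sum_subtractf)
  qed
  show ?thesis
    using lie_bracket_entry[OF root_mat_in_so_odd[OF assms(1,2)] assms(3,4,5)] 1 2 by simp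
qed

text \<open>Only the product of the matrix units \<open>E(a,b)\<close> and \<open>E(b,c)\<close> and its mirror image survive. If
  \<open>b = a'\<close> or \<open>c = b'\<close>, then one of the two factors is zero, and for \<open>a = c\<close> the bracket lies in the
  Cartan subalgebra.\<close>

lemma lie_bracket_root_mats:
  assumes "a \<le> 2*n" "b \<le> 2*n" "c \<le> 2*n" "a \<noteq> c" "a + b \<noteq> 2*n" "b + c \<noteq> 2*n"
  shows "lie_bracket (root_mat n a b) (root_mat n b c) = root_mat n a c"
proof (rule eq_matI)
  show "dim_row (lie_bracket (root_mat n a b) (root_mat n b c)) = dim_row (root_mat n a c)"
    "dim_col (lie_bracket (root_mat n a b) (root_mat n b c)) = dim_col (root_mat n a c)"
    by (simp_all add: lie_bracket_def)
next
  fix i j assume "i < dim_row (root_mat n a c)" "j < dim_col (root_mat n a c)"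
  then have ij: "i \<le> 2*n" "j \<le> 2*n" by simp_all
  have d: "2*n - x \<le> 2*n" for x by simp
  define a' b' c' where prime_def: "a' = 2*n-a" "b' = 2*n-b" "c' = 2*n-c"
  note prime = prime_def[symmetric]
  have ne: "b \<noteq> a'" "a' \<noteq> b" "a \<noteq> b'" "b' \<noteq> a" "b \<noteq> c'" "c' \<noteq> b" "c \<noteq> b'" "b' \<noteq> c"
    "a' \<noteq> c'" "c' \<noteq> a'"
    using assms unfolding prime_def by linarith+
  have le: "a' \<le> 2*n" "b' \<le> 2*n" by (simp_all add: prime_def)
  have entries: "root_mat n b c $$ (b,j) = (if j = c then 1 else 0)" "root_mat n b c $$ (a',j) = 0"
    "root_mat n b c $$ (i,a) = 0" "root_mat n b c $$ (i,b') = (if i = c' then -1 else 0)"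
    using ne assms(4) unfolding root_mat_entry[OF assms(2) ij(2)] root_mat_entry[OF le(1) ij(2)]
      root_mat_entry[OF ij(1) assms(1)] root_mat_entry[OF ij(1) le(2)] prime
    by simp_all
  show "lie_bracket (root_mat n a b) (root_mat n b c) $$ (i,j) = root_mat n a c $$ (i,j)"
    unfolding lie_bracket_root_mat_entry[OF assms(1,2) root_mat_in_so_odd[OF assms(2,3)] ij]
      root_mat_entry[OF ij] prime entries
    by (cases "i = a"; cases "j = c"; cases "i = c'"; cases "j = a'") simp_all
qed

lemma lie_bracket_cartan_root_mat:
  assumes H: "H \<in> cartan n" and ij: "i \<le> 2*n" "j \<le> 2*n"
  shows "lie_bracket H (root_mat n i j) = (H $$ (i,i) - H $$ (j,j)) \<cdot>\<^sub>m root_mat n i j"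
proof (rule eq_matI)
  note Hs = cartan_so_odd[OF H]
  show "dim_row (lie_bracket H (root_mat n i j)) = dim_row ((H $$ (i,i) - H $$ (j,j)) \<cdot>\<^sub>m root_mat n i j)"
    "dim_col (lie_bracket H (root_mat n i j)) = dim_col ((H $$ (i,i) - H $$ (j,j)) \<cdot>\<^sub>m root_mat n i j)"
    using Hs by (simp_all add: lie_bracket_def)
  fix a b
  assume "a < dim_row ((H $$ (i,i) - H $$ (j,j)) \<cdot>\<^sub>m root_mat n i j)"
    "b < dim_col ((H $$ (i,i) - H $$ (j,j)) \<cdot>\<^sub>m root_mat n i j)"
  then have ab: "a \<le> 2*n" "b \<le> 2*n" by simp_all
  have sH: "H $$ (2*n-i,2*n-i) = - H $$ (i,i)" "H $$ (2*n-j,2*n-j) = - H $$ (j,j)"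
    using so_odd_entry[OF Hs] ij by simp_all
  have "lie_bracket H (root_mat n i j) $$ (a,b)
      = H $$ (a,a) * root_mat n i j $$ (a,b) - root_mat n i j $$ (a,b) * H $$ (b,b)"
  proof -
    have "(\<Sum>l\<le>2*n. H $$ (a,l) * root_mat n i j $$ (l,b))
        = (\<Sum>l\<le>2*n. if l = a then H $$ (a,a) * root_mat n i j $$ (a,b) else 0)"
      by (rule sum.cong) (use ab in \<open>auto simp: cartan_off_diagonal[OF H]\<close>)
    moreover have "(\<Sum>l\<le>2*n. root_mat n i j $$ (a,l) * H $$ (l,b))
        = (\<Sum>l\<le>2*n. if l = b then root_mat n i j $$ (a,b) * H $$ (b,b) else 0)"
      by (rule sum.cong) (use ab in \<open>auto simp: cartan_off_diagonal[OF H]\<close>)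
    ultimately show ?thesis
      using lie_bracket_entry[OF Hs root_mat_in_so_odd[OF ij] ab] ab by simp
  qed
  moreover have "H $$ (a,a) * R - R * H $$ (b,b) = (H $$ (i,i) - H $$ (j,j)) * R"
    if R: "R = (if a = i \<and> b = j then 1 else 0) - (if a = 2*n-j \<and> b = 2*n-i then 1 else 0)" for R
  proof -
    have "R = 0" if "\<not> (a = i \<and> b = j)" "\<not> (a = 2*n-j \<and> b = 2*n-i)"
      unfolding R if_not_P[OF that(1)] if_not_P[OF that(2)] by simp
    moreover have "H $$ (a,a) - H $$ (b,b) = H $$ (i,i) - H $$ (j,j)" if "a = i" "b = j"
      unfolding that ..
    moreover have "H $$ (a,a) - H $$ (b,b) = H $$ (i,i) - H $$ (j,j)" if "a = 2*n-j" "b = 2*n-i"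
      unfolding that sH by simp
    ultimately have "R = 0 \<or> H $$ (a,a) - H $$ (b,b) = H $$ (i,i) - H $$ (j,j)" by blast
    then show ?thesis by (metis left_diff_distrib mult.commute mult_zero_right)
  qed
  ultimately show "lie_bracket H (root_mat n i j) $$ (a,b)
      = ((H $$ (i,i) - H $$ (j,j)) \<cdot>\<^sub>m root_mat n i j) $$ (a,b)"
    using ab root_mat_entry[OF ab] by simp
qed

text \<open>Splitting off one step reduces every root vector to those next to the diagonal. Root vectors on
  the antidiagonal vanish, so neither half may lie there: \<open>(i,j)\<close> is split at \<open>i + 1\<close> if
  \<open>i + j = 2n + 1\<close>, and at \<open>j - 1\<close> otherwise. Parity rules out the remaining coincidences.\<close>

lemma root_index_induct [consumes 2, case_names step bracket]:
  fixes i j n :: nat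
  assumes "i < j" "j \<le> 2*n"
    and step: "\<And>i. i < 2*n \<Longrightarrow> P i (i+1)"
    and bracket: "\<And>a b c. a < b \<Longrightarrow> b < c \<Longrightarrow> c \<le> 2*n \<Longrightarrow> a + b \<noteq> 2*n \<Longrightarrow> b + c \<noteq> 2*n
       \<Longrightarrow> P a b \<Longrightarrow> P b c \<Longrightarrow> P a c"
  shows "P i j"
  using assms(1,2)
proof (induction "j - i" arbitrary: i j rule: less_induct)
  case less
  consider "j = i + 1" | "j > i + 1" "i + j = 2*n+1" | "j > i + 1" "i + j \<noteq> 2*n+1"
    using less.prems by linarith
  then show ?case
  proof cases
    case 1
    then show ?thesis using step[of i] less.prems by simp
  next
    case 2
    have "i + (i+1) \<noteq> 2*n" by presburger
    moreover have "P (i+1) j" by (rule less.hyps) (use 2 less.prems in auto)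
    ultimately show ?thesis
      using bracket[of i "i+1" j] step[of i] 2 less.prems by auto
  next
    case 3
    have "(j-1) + j \<noteq> 2*n" using 3 by presburger
    moreover have "P i (j-1)" by (rule less.hyps) (use 3 less.prems in auto)
    ultimately show ?thesis
      using bracket[of i "j-1" j] step[of "j-1"] 3 less.prems by auto
  qed
qed

lemma root_mat_flip:
  assumes "i \<le> 2*n" "j \<le> 2*n"
  shows "root_mat n (2*n-j) (2*n-i) = (-1) \<cdot>\<^sub>m root_mat n i j"
proof (rule eq_matI, goal_cases)
  case (1 a b)
  then have "a \<le> 2*n" "b \<le> 2*n" by simp_all
  then show ?case by (simp add: root_mat_entry diff_diff_cancel[OF assms(1)] diff_diff_cancel[OF assms(2)])
qed simp_all

text \<open>Induction over sets of index pairs replaces a sum of matrices, for which there is no zero element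
  common to all dimensions.\<close>

lemma so_odd_eqI:
  assumes L: "L \<subseteq> so_odd n"
    and add: "\<And>X Y. X \<in> L \<Longrightarrow> Y \<in> L \<Longrightarrow> X + Y \<in> L"
    and smult: "\<And>c X. X \<in> L \<Longrightarrow> c \<cdot>\<^sub>m X \<in> L"
    and root_vec: "\<And>i j. i \<le> 2*n \<Longrightarrow> j \<le> 2*n \<Longrightarrow> root_mat n i j \<in> L"
  shows "L = so_odd n"
proof (intro equalityI subsetI)
  fix X assume X: "X \<in> so_odd n"
  \<comment> \<open>Halving the entries compensates that each element occurs twice, up to sign, among the
      matrices that span.\<close>
  define M where "M A = mat (2*n+1) (2*n+1)
     (\<lambda>(a,b). \<Sum>(i,j)\<in>A. X $$ (i,j) / 2 * root_mat n i j $$ (a,b))" for A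
  have M_in: "M A \<in> L" if "finite A" "A \<subseteq> {..2*n} \<times> {..2*n}" for A
    using that
  proof (induction A rule: finite_induct)
    case empty
    have "M {} = 0 \<cdot>\<^sub>m root_mat n 0 0"
      by (rule eq_matI) (auto simp: M_def)
    then show ?case using smult[OF root_vec] by simp
  next
    case (insert p A)
    obtain i j where p: "p = (i,j)" by (cases p)
    have "M (insert p A) = (X $$ (i,j) / 2) \<cdot>\<^sub>m root_mat n i j + M A"
      
    proof (rule eq_matI, goal_cases)
      case (1 a b)
      then have "a \<le> 2*n" "b \<le> 2*n" by (simp_all add: M_def)
      then show ?case using insert.hyps by (simp add: M_def p)
    qed (simp_all add: M_def)
    moreover have "root_mat n i j \<in> L" using insert.prems p by (intro root_vec) auto
    ultimately show ?case using insert by (auto intro!: add smult)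
  qed
  have "M ({..2*n} \<times> {..2*n}) = X"
  proof (rule eq_matI)
    fix a b assume "a < dim_row X" "b < dim_col X"
    then have ab: "a \<le> 2*n" "b \<le> 2*n" using X by simp_all
    have "M ({..2*n} \<times> {..2*n}) $$ (a,b)
        = (\<Sum>i\<le>2*n. \<Sum>j\<le>2*n. X $$ (i,j) / 2 * root_mat n i j $$ (a,b))"
      using ab by (simp add: M_def sum.cartesian_product)
    also have "\<dots> = (\<Sum>i\<le>2*n. \<Sum>j\<le>2*n.
        (if j = b then if i = a then X $$ (i,j) / 2 else 0 else 0) -
        (if j = 2*n-a then if i = 2*n-b then X $$ (i,j) / 2 else 0 else 0))"
    proof (intro sum.cong refl)
      fix i j assume "i \<in> {..2*n}" "j \<in> {..2*n}"
      then have "(a = 2*n-j \<and> b = 2*n-i) = (j = 2*n-a \<and> i = 2*n-b)" "(a = i \<and> b = j) = (j = b \<and> i = a)"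
        using ab by auto
      then show "X $$ (i,j) / 2 * root_mat n i j $$ (a,b) =
        (if j = b then if i = a then X $$ (i,j) / 2 else 0 else 0) -
        (if j = 2*n-a then if i = 2*n-b then X $$ (i,j) / 2 else 0 else 0)"
        by (simp add: root_mat_entry[OF ab] right_diff_distrib)
    qed
    also have "\<dots> = X $$ (a,b) / 2 - X $$ (2*n-b,2*n-a) / 2"
      using ab by (simp add: sum_subtractf)
    also have "\<dots> = X $$ (a,b)"
      using so_odd_entry[OF X ab] by simp
    finally show "M ({..2*n} \<times> {..2*n}) $$ (a,b) = X $$ (a,b)" .
  qed (use X in \<open>simp_all add: M_def\<close>)
  then show "X \<in> L" using M_in[of "{..2*n} \<times> {..2*n}"] by simp
qed (use L in auto)

section \<open>Representations and highest weight vectors\<close>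

lemma lie_bracket_smult:
  assumes "X \<in> so_odd n" "Y \<in> so_odd n"
  shows "lie_bracket X (c \<cdot>\<^sub>m Y) = c \<cdot>\<^sub>m lie_bracket X Y"
proof (rule eq_matI)
  fix i j assume "i < dim_row (c \<cdot>\<^sub>m lie_bracket X Y)" "j < dim_col (c \<cdot>\<^sub>m lie_bracket X Y)"
  then have ij: "i \<le> 2*n" "j \<le> 2*n" using assms by (simp_all add: lie_bracket_def)
  have "(\<Sum>l\<le>2*n. X $$ (i,l) * (c \<cdot>\<^sub>m Y) $$ (l,j)) = c * (\<Sum>l\<le>2*n. X $$ (i,l) * Y $$ (l,j))"
    "(\<Sum>l\<le>2*n. (c \<cdot>\<^sub>m Y) $$ (i,l) * X $$ (l,j)) = c * (\<Sum>l\<le>2*n. Y $$ (i,l) * X $$ (l,j))"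
    unfolding sum_distrib_left using assms ij by (auto intro!: sum.cong)
  then have "lie_bracket X (c \<cdot>\<^sub>m Y) $$ (i,j) = c * lie_bracket X Y $$ (i,j)"
    by (simp only: lie_bracket_entry[OF assms(1) smult_in_so_odd[OF assms(2)] ij]
        lie_bracket_entry[OF assms ij] right_diff_distrib)
  then show "lie_bracket X (c \<cdot>\<^sub>m Y) $$ (i,j) = (c \<cdot>\<^sub>m lie_bracket X Y) $$ (i,j)"
    using ij lie_bracket_in_so_odd[OF assms] by simp
qed (use assms in \<open>simp_all add: lie_bracket_def\<close>)

text \<open>The scalar is the value of \<open>-\<alpha>\<^sub>k\<close> at \<open>H\<close>.\<close>

lemma lie_bracket_cartan_chev_f:
  assumes H: "H \<in> cartan n" and k: "k \<in> {1..n}"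
  shows "lie_bracket H (chev_f n k) = (H $$ (k,k) - H $$ (k-1,k-1)) \<cdot>\<^sub>m chev_f n k"
proof -
  have r: "root_mat n k (k-1) \<in> so_odd n" using k by (intro root_mat_in_so_odd) auto
  have b: "lie_bracket H (root_mat n k (k-1)) = (H $$ (k,k) - H $$ (k-1,k-1)) \<cdot>\<^sub>m root_mat n k (k-1)"
    by (rule lie_bracket_cartan_root_mat[OF H]) (use k in auto)
  show ?thesis
    unfolding chev_f_eq[OF k] lie_bracket_smult[OF cartan_so_odd[OF H] r] b
    by (rule eq_matI) simp_all
qed

lemma lie_bracket_chev_e_chev_f:
  assumes k: "k \<in> {1..n}" and j: "j \<in> {1..n}"
  shows "lie_bracket (chev_e n k) (chev_f n j) \<in> cartan n"
proof (rule cartanI)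
  show "lie_bracket (chev_e n k) (chev_f n j) \<in> so_odd n"
    using chev_in_so_odd[OF k] chev_in_so_odd[OF j] by (simp add: lie_bracket_in_so_odd)
next
  fix a b assume ab: "a \<le> 2*n" "b \<le> 2*n" "a \<noteq> b"
  have r: "root_mat n (k-1) k \<in> so_odd n" "root_mat n j (j-1) \<in> so_odd n"
    using k j by (auto intro!: root_mat_in_so_odd)
  have le: "k - 1 \<le> 2*n" "k \<le> 2*n" "2*n - k \<le> 2*n" "2*n - (k-1) \<le> 2*n"
    using k by auto
  have zero: "root_mat n j (j-1) $$ (x,y) = 0" if "x \<le> 2*n" "y \<le> 2*n"
    "\<not> (x = j \<and> y = j-1)" "\<not> (x = 2*n-(j-1) \<and> y = 2*n-j)" for x y
    unfolding root_mat_entry[OF that(1,2)] if_not_P[OF that(3)] if_not_P[OF that(4)] by simp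
  have "root_mat n j (j-1) $$ (k,b) = 0" if "a = k-1"
    by (rule zero) (use k j ab that in auto)
  moreover have "root_mat n j (j-1) $$ (2*n-(k-1),b) = 0" if "a = 2*n-k"
    by (rule zero) (use k j ab that in auto)
  moreover have "root_mat n j (j-1) $$ (a,k-1) = 0" if "b = k"
    by (rule zero) (use k j ab that in auto)
  moreover have "root_mat n j (j-1) $$ (a,2*n-k) = 0" if "b = 2*n-(k-1)"
    by (rule zero) (use k j ab that in auto)
  ultimately have "lie_bracket (root_mat n (k-1) k) (root_mat n j (j-1)) $$ (a,b) = 0"
    unfolding lie_bracket_root_mat_entry[OF le(1,2) r(2) ab(1,2)] by simp
  then have "((if j = n then 2 else 1) \<cdot>\<^sub>m lie_bracket (root_mat n (k-1) k) (root_mat n j (j-1))) $$ (a,b) = 0"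
    using ab lie_bracket_in_so_odd[OF r] by simp
  then show "lie_bracket (chev_e n k) (chev_f n j) $$ (a,b) = 0"
    unfolding chev_e_eq[OF k] chev_f_eq[OF j] lie_bracket_smult[OF r] .
qed

text \<open>Brackets reach every root vector above the diagonal from the \<open>e\<^sub>k\<close> and every one below it from
  the \<open>f\<^sub>k\<close>. Next to the diagonal, in the positions \<open>(i,i+1)\<close> and \<open>(i+1,i)\<close>, these generators cover only
  \<open>i < n\<close>, and the others are mirror images.\<close>

lemma so_odd_generated:
  assumes L: "L \<subseteq> so_odd n"
    and add: "\<And>X Y. X \<in> L \<Longrightarrow> Y \<in> L \<Longrightarrow> X + Y \<in> L"
    and smult: "\<And>c X. X \<in> L \<Longrightarrow> c \<cdot>\<^sub>m X \<in> L"
    and bracket: "\<And>X Y. X \<in> L \<Longrightarrow> Y \<in> L \<Longrightarrow> lie_bracket X Y \<in> L"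
    and cartan: "cartan n \<subseteq> L"
    and e: "\<And>k. k \<in> {1..n} \<Longrightarrow> chev_e n k \<in> L"
    and f: "\<And>k. k \<in> {1..n} \<Longrightarrow> chev_f n k \<in> L"
  shows "L = so_odd n"
proof (rule so_odd_eqI[OF L add smult])
  have up0: "root_mat n i (i+1) \<in> L" if "i < n" for i
    using e[of "i+1"] chev_e_eq[of "i+1" n] that by simp
  have down0: "root_mat n (i+1) i \<in> L" if "i < n" for i
  proof -
    have "(1 / (if i+1 = n then 2 else 1)) \<cdot>\<^sub>m chev_f n (i+1) \<in> L"
      using f[of "i+1"] that by (intro smult) auto
    also have "(1 / (if i+1 = n then 2 else 1)) \<cdot>\<^sub>m chev_f n (i+1) = root_mat n (i+1) i"
      by (rule eq_matI) (use that in \<open>auto simp: chev_f_eq\<close>)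
    finally show ?thesis .
  qed
  have up1: "root_mat n i (i+1) \<in> L" if "i < 2*n" for i
  proof (cases "i < n")
    case False
    have "2*n-i-1+1 = 2*n-i" using that by simp
    then have "root_mat n i (i+1) = (-1) \<cdot>\<^sub>m root_mat n (2*n-i-1) (2*n-i-1+1)"
      using root_mat_flip[of "2*n-i-1" n "2*n-i"] that by (simp only:) simp
    then show ?thesis using smult[OF up0[of "2*n-i-1"]] False that by auto
  qed (rule up0)
  have down1: "root_mat n (i+1) i \<in> L" if "i < 2*n" for i
  proof (cases "i < n")
    case False
    have "2*n-i-1+1 = 2*n-i" using that by simp
    then have "root_mat n (i+1) i = (-1) \<cdot>\<^sub>m root_mat n (2*n-i-1+1) (2*n-i-1)"
      using root_mat_flip[of "2*n-i" n "2*n-i-1"] that by (simp only:) simp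
    then show ?thesis using smult[OF down0[of "2*n-i-1"]] False that by auto
  qed (rule down0)
  fix i j assume ij: "i \<le> 2*n" "j \<le> 2*n"
  consider "i = j" | "i < j" | "j < i" by linarith
  then show "root_mat n i j \<in> L"
  proof cases
    case 1
    then show ?thesis using root_mat_diag_cartan ij cartan by auto
  next
    case 2
    then show ?thesis using ij(2)
    proof (induction rule: root_index_induct)
      case (bracket a b c)
      then show ?case
        using lie_bracket_root_mats[of a n b c] assms(4)[of "root_mat n a b" "root_mat n b c"] by simp
    qed (rule up1)
  next
    case 3
    then show ?thesis using ij(1)
    proof (induction rule: root_index_induct)
      case (bracket a b c)
      then show ?case
        using lie_bracket_root_mats[of c n b a] assms(4)[of "root_mat n c b" "root_mat n b a"] 
        by (simp add: add.commute)
    qed (rule down1)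
  qed
qed

text \<open>All simple roots take the value 1 here, so this one element grades a highest weight
  representation by depth.\<close>

definition height_mat :: "nat \<Rightarrow> complex mat" where
  "height_mat n = mat (2*n+1) (2*n+1) (\<lambda>(i,j). if i = j then of_nat n - of_nat i else 0)"

lemma height_mat_cartan: "height_mat n \<in> cartan n"
proof (rule cartanI)
  have "height_mat n $$ (2*n-j, 2*n-i) = - height_mat n $$ (i, j)" if "i \<le> 2*n" "j \<le> 2*n" for i j
    using that by (auto simp: height_mat_def of_nat_diff)
  then show "height_mat n \<in> so_odd n"
    by (auto simp: in_so_odd_iff height_mat_def)
qed (auto simp: height_mat_def)

lemma lie_bracket_height_chev_f:
  assumes "k \<in> {1..n}"
  shows "lie_bracket (height_mat n) (chev_f n k) = (-1) \<cdot>\<^sub>m chev_f n k"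
proof -
  have "height_mat n $$ (k,k) - height_mat n $$ (k-1,k-1) = -1"
    using assms by (auto simp: height_mat_def of_nat_diff)
  then show ?thesis
    using lie_bracket_cartan_chev_f[OF height_mat_cartan assms] by simp
qed

locale so_module =
  fixes n :: nat and scl :: "complex \<Rightarrow> 'v::ab_group_add \<Rightarrow> 'v" and V :: "'v set"
    and \<rho> :: "complex mat \<Rightarrow> 'v \<Rightarrow> 'v"
  assumes rep: "so_rep n scl V \<rho>"

sublocale so_module \<subseteq> vector_space scl
  using rep by (simp add: so_rep_def)

context so_module
begin

lemma subspace_V: "subspace V"
  and act_in: "X \<in> so_odd n \<Longrightarrow> v \<in> V \<Longrightarrow> \<rho> X v \<in> V"
  and act_add: "X \<in> so_odd n \<Longrightarrow> v \<in> V \<Longrightarrow> w \<in> V \<Longrightarrow> \<rho> X (v + w) = \<rho> X v + \<rho> X w"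
  and act_scale: "X \<in> so_odd n \<Longrightarrow> v \<in> V \<Longrightarrow> \<rho> X (scl c v) = scl c (\<rho> X v)"
  and add_act: "X \<in> so_odd n \<Longrightarrow> Y \<in> so_odd n \<Longrightarrow> v \<in> V \<Longrightarrow> \<rho> (X + Y) v = \<rho> X v + \<rho> Y v"
  and smult_act: "X \<in> so_odd n \<Longrightarrow> v \<in> V \<Longrightarrow> \<rho> (c \<cdot>\<^sub>m X) v = scl c (\<rho> X v)"
  and bracket_act: "X \<in> so_odd n \<Longrightarrow> Y \<in> so_odd n \<Longrightarrow> v \<in> V \<Longrightarrow>
     \<rho> (lie_bracket X Y) v = \<rho> X (\<rho> Y v) - \<rho> Y (\<rho> X v)"
  using rep by (auto simp: so_rep_def)

lemma act_zero: "X \<in> so_odd n \<Longrightarrow> \<rho> X 0 = 0"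
  using act_scale[of X 0 0] subspace_0[OF subspace_V] by simp

lemma act_sum:
  assumes "X \<in> so_odd n" "\<And>i. i \<in> F \<Longrightarrow> y i \<in> V"
  shows "\<rho> X (\<Sum>i\<in>F. y i) = (\<Sum>i\<in>F. \<rho> X (y i))"
  using assms(2)
proof (induction F rule: infinite_finite_induct)
  case (insert i F)
  then show ?case
    using act_add[OF assms(1), of "y i" "sum y F"] by (simp add: subspace_sum[OF subspace_V])
qed (simp_all add: act_zero[OF assms(1)])

lemma subspace_preimage:
  assumes X: "X \<in> so_odd n" and "subspace T"
  shows "subspace {x \<in> V. \<rho> X x \<in> T}"
  unfolding subspace_def
  using subspace_V assms
  by (auto simp: act_zero act_add act_scale subspace_0 subspace_add subspace_scale)

lemma act_span:
  assumes X: "X \<in> so_odd n" and T: "subspace T" and "S \<subseteq> V" "\<And>s. s \<in> S \<Longrightarrow> \<rho> X s \<in> T" "x \<in> span S"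
  shows "\<rho> X x \<in> T"
  using span_minimal[OF _ subspace_preimage[OF X T], of S] assms by auto

lemma subspace_eigenspace:
  assumes X: "X \<in> so_odd n"
  shows "subspace {x \<in> V. \<rho> X x = scl c x}"
  unfolding subspace_def using subspace_V X
  by (auto simp: act_zero act_add act_scale subspace_0 subspace_add subspace_scale
      scale_right_distrib mult.commute)

text \<open>Eigenvectors for distinct eigenvalues are independent modulo any subspace that is stable under
  the operator: applying the operator minus one eigenvalue removes the corresponding summand.\<close>

lemma eigenvector_components:
  assumes X: "X \<in> so_odd n" and U: "subspace U" and XU: "\<And>u. u \<in> U \<Longrightarrow> \<rho> X u \<in> U"
    and "finite F" "inj_on a F" "\<And>i. i \<in> F \<Longrightarrow> y i \<in> V" "\<And>i. i \<in> F \<Longrightarrow> \<rho> X (y i) = scl (a i) (y i)"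
    and "(\<Sum>i\<in>F. y i) \<in> U" "i \<in> F"
  shows "y i \<in> U"
  using assms(4-)
proof (induction F arbitrary: y i rule: finite_induct)
  case (insert j F)
  have "\<rho> X (\<Sum>i\<in>insert j F. y i) = (\<Sum>i\<in>insert j F. scl (a i) (y i))"
    by (subst act_sum[OF X]) (use insert.prems in \<open>auto intro!: sum.cong\<close>)
  then have "\<rho> X (\<Sum>i\<in>insert j F. y i) - scl (a j) (\<Sum>i\<in>insert j F. y i)
      = (\<Sum>i\<in>insert j F. scl (a i) (y i) - scl (a j) (y i))"
    by (simp only: scale_sum_right sum_subtractf)
  also have "\<dots> = (\<Sum>i\<in>F. scl (a i - a j) (y i))"
    using insert.hyps by (simp add: scale_left_diff_distrib)
  finally have "(\<Sum>i\<in>F. scl (a i - a j) (y i)) \<in> U"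
    using insert.prems(4) by (metis XU U subspace_diff subspace_scale)
  moreover have "\<rho> X (scl (a i - a j) (y i)) = scl (a i) (scl (a i - a j) (y i))" if "i \<in> F" for i
    using that insert.prems(2,3) X by (simp add: act_scale mult.commute)
  ultimately have scaled: "scl (a i - a j) (y i) \<in> U" if "i \<in> F" for i
    using insert.IH[of "\<lambda>i. scl (a i - a j) (y i)" i] insert.prems(1,2) that
    by (auto simp: subspace_scale[OF subspace_V])
  have rest: "y i \<in> U" if "i \<in> F" for i
  proof -
    have "a i \<noteq> a j" using that insert.prems(1) insert.hyps by (auto simp: inj_on_def)
    then have "y i = scl (1 / (a i - a j)) (scl (a i - a j) (y i))" by simp
    also have "\<dots> \<in> U" by (rule subspace_scale[OF U scaled[OF that]])
    finally show ?thesis .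
  qed
  show ?case
  proof (cases "i = j")
    case True
    have "y j = (\<Sum>i\<in>insert j F. y i) - (\<Sum>i\<in>F. y i)" using insert.hyps by simp
    also have "\<dots> \<in> U" by (rule subspace_diff[OF U insert.prems(4) subspace_sum[OF U rest]])
    finally show ?thesis using True by simp
  qed (use rest insert.prems in auto)
qed simp

end

primrec f_layer :: "nat \<Rightarrow> (complex \<Rightarrow> 'v::ab_group_add \<Rightarrow> 'v) \<Rightarrow> (complex mat \<Rightarrow> 'v \<Rightarrow> 'v) \<Rightarrow> 'v
    \<Rightarrow> nat \<Rightarrow> 'v set" where
  "f_layer n scl \<rho> v 0 = module.span scl {v}"
| "f_layer n scl \<rho> v (Suc m) =
     module.span scl (\<Union>k\<in>{1..n}. \<rho> (chev_f n k) ` f_layer n scl \<rho> v m)"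

text \<open>The subrepresentation generated by a highest weight vector \<open>v\<close> is spanned by the vectors obtained
  from \<open>v\<close> by applying lowering operators: \<open>e\<^sub>k\<close> can be commuted past each \<open>f\<^sub>j\<close>, as \<open>[e\<^sub>k, f\<^sub>j]\<close> lies in
  the Cartan subalgebra, until it meets \<open>v\<close>. The height element acts on products of \<open>m\<close> lowering
  operators applied to \<open>v\<close> by its value under \<open>\<mu>\<close> minus \<open>m\<close>, so the top eigenspace is the line of \<open>v\<close>.\<close>

lemma (in so_module) highest_weight_submodule:
  assumes v: "v \<in> V" and ev: "\<And>k. k \<in> {1..n} \<Longrightarrow> \<rho> (chev_e n k) v = 0"
    and Hv: "\<And>H. H \<in> cartan n \<Longrightarrow> \<rho> H v = scl (\<mu> H) v"
  obtains U where "invariant_subspace n scl V \<rho> U" "v \<in> U"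
    "\<And>x. x \<in> U \<Longrightarrow> \<rho> (height_mat n) x = scl (\<mu> (height_mat n)) x \<Longrightarrow> \<exists>c. x = scl c v"
proof -
  define G where "G = f_layer n scl \<rho> v"
  have G0: "G 0 = span {v}" and GS: "G (Suc m) = span (\<Union>k\<in>{1..n}. \<rho> (chev_f n k) ` G m)" for m
    by (simp_all add: G_def)
  have subG: "subspace (G m)" for m by (cases m) (simp_all add: G0 GS)
  have GV: "G m \<subseteq> V" for m
  proof (induction m)
    case 0
    then show ?case using span_minimal[OF _ subspace_V] v by (simp add: G0)
  next
    case (Suc m)
    then show ?case unfolding GS
      by (intro span_minimal[OF _ subspace_V]) (auto intro!: act_in chev_in_so_odd)
  qed
  have gensV: "(\<Union>k\<in>{1..n}. \<rho> (chev_f n k) ` G m) \<subseteq> V" for m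
    using GV by (auto intro!: act_in chev_in_so_odd)
  have fG: "\<rho> (chev_f n k) x \<in> G (Suc m)" if "k \<in> {1..n}" "x \<in> G m" for k x m
    unfolding GS using that by (intro span_base) auto
  have HG: "\<rho> H x \<in> G m" if H: "H \<in> cartan n" and x: "x \<in> G m" for H x m
    using x
  proof (induction m arbitrary: x)
    case 0
    show ?case
      by (rule act_span[OF cartan_so_odd[OF H] subG, of "{v}"])
        (use v Hv[OF H] 0 in \<open>auto simp: G0 span_scale span_base\<close>)
  next
    case (Suc m)
    show ?case
    proof (rule act_span[OF cartan_so_odd[OF H] subG gensV])
      fix s assume "s \<in> (\<Union>k\<in>{1..n}. \<rho> (chev_f n k) ` G m)"
      then obtain k u where k: "k \<in> {1..n}" and u: "u \<in> G m" and s: "s = \<rho> (chev_f n k) u" by auto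
      have uV: "u \<in> V" using u GV by auto
      have "\<rho> H s = \<rho> (chev_f n k) (\<rho> H u) + \<rho> (lie_bracket H (chev_f n k)) u"
        using bracket_act[OF cartan_so_odd[OF H] chev_in_so_odd(2)[OF k] uV] s by simp
      also have "\<dots> = \<rho> (chev_f n k) (\<rho> H u) + scl (H $$ (k,k) - H $$ (k-1,k-1)) (\<rho> (chev_f n k) u)"
        using smult_act[OF chev_in_so_odd(2)[OF k] uV] lie_bracket_cartan_chev_f[OF H k] by simp
      also have "\<dots> \<in> G (Suc m)"
        by (intro subspace_add subspace_scale subG fG k u Suc.IH)
      finally show "\<rho> H s \<in> G (Suc m)" .
    qed (use Suc.prems GS in auto)
  qed
  have eG0: "\<rho> (chev_e n k) x = 0" if k: "k \<in> {1..n}" and x: "x \<in> G 0" for k x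
    using act_span[OF chev_in_so_odd(1)[OF k] subspace_single_0, of "{v}" x] v ev[OF k] x G0 by auto
  \<comment> \<open>Moving \<open>e\<close> past the first \<open>f\<close>; \<open>e\<close> then acts one layer closer to \<open>v\<close>.\<close>
  have commute: "\<rho> (chev_e n k) x \<in> G m" if k: "k \<in> {1..n}" and x: "x \<in> G (Suc m)"
    and rest: "\<And>j u. j \<in> {1..n} \<Longrightarrow> u \<in> G m \<Longrightarrow> \<rho> (chev_f n j) (\<rho> (chev_e n k) u) \<in> G m" for k x m
  proof (rule act_span[OF chev_in_so_odd(1)[OF k] subG gensV])
    fix s assume "s \<in> (\<Union>k\<in>{1..n}. \<rho> (chev_f n k) ` G m)"
    then obtain j u where j: "j \<in> {1..n}" and u: "u \<in> G m" and s: "s = \<rho> (chev_f n j) u" by auto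
    have uV: "u \<in> V" using u GV by auto
    have "\<rho> (chev_e n k) s =
        \<rho> (chev_f n j) (\<rho> (chev_e n k) u) + \<rho> (lie_bracket (chev_e n k) (chev_f n j)) u"
      using bracket_act[OF chev_in_so_odd(1)[OF k] chev_in_so_odd(2)[OF j] uV] s by simp
    also have "\<dots> \<in> G m"
      by (intro subspace_add subG rest j u HG lie_bracket_chev_e_chev_f k)
    finally show "\<rho> (chev_e n k) s \<in> G m" .
  qed (use x GS in auto)
  have eG: "\<rho> (chev_e n k) x \<in> G m" if k: "k \<in> {1..n}" and "x \<in> G (Suc m)" for k x m
    using that(2)
  proof (induction m arbitrary: x)
    case 0
    show ?case
      by (rule commute[OF k 0])
        (simp add: eG0[OF k] act_zero[OF chev_in_so_odd(2)] subspace_0[OF subG])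
  next
    case (Suc m)
    show ?case by (rule commute[OF k Suc.prems]) (intro fG Suc.IH)
  qed
  have heightG: "\<rho> (height_mat n) x = scl (\<mu> (height_mat n) - of_nat m) x" if "x \<in> G m" for x m
    using that
  proof (induction m arbitrary: x)
    case 0
    have "span {v} \<subseteq> {x \<in> V. \<rho> (height_mat n) x = scl (\<mu> (height_mat n)) x}"
      using v Hv[OF height_mat_cartan]
      by (intro span_minimal subspace_eigenspace cartan_so_odd height_mat_cartan) auto
    then show ?case using 0 G0 by auto
  next
    case (Suc m)
    let ?E = "{x \<in> V. \<rho> (height_mat n) x = scl (\<mu> (height_mat n) - of_nat (Suc m)) x}"
    have "\<rho> (chev_f n k) u \<in> ?E" if k: "k \<in> {1..n}" and u: "u \<in> G m" for k u
    proof -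
      note H = cartan_so_odd[OF height_mat_cartan, of n]
      have uV: "u \<in> V" using u GV by auto
      have "\<rho> (height_mat n) (\<rho> (chev_f n k) u)
          = \<rho> (chev_f n k) (\<rho> (height_mat n) u) + \<rho> (lie_bracket (height_mat n) (chev_f n k)) u"
        using bracket_act[OF H chev_in_so_odd(2)[OF k] uV] by simp
      also have "\<dots> = scl (\<mu> (height_mat n) - of_nat m) (\<rho> (chev_f n k) u)
          + scl (-1) (\<rho> (chev_f n k) u)"
        by (simp only: lie_bracket_height_chev_f[OF k] Suc.IH[OF u]
            smult_act[OF chev_in_so_odd(2)[OF k] uV] act_scale[OF chev_in_so_odd(2)[OF k] uV])
      also have "\<dots> = scl (\<mu> (height_mat n) - of_nat (Suc m)) (\<rho> (chev_f n k) u)"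
        by (simp add: scale_left_diff_distrib scale_left_distrib)
      finally show ?thesis using act_in[OF chev_in_so_odd(2)[OF k] uV] by simp
    qed
    then have "G (Suc m) \<subseteq> ?E"
      unfolding GS by (intro span_minimal subspace_eigenspace cartan_so_odd height_mat_cartan) auto
    then show ?case using Suc.prems by auto
  qed
  define U where "U = span (\<Union>m. G m)"
  have subU: "subspace U" by (simp add: U_def)
  have GU: "G m \<subseteq> U" for m unfolding U_def by (auto intro: span_base)
  have gensU: "(\<Union>m. G m) \<subseteq> V" using GV by auto
  have UV: "U \<subseteq> V" unfolding U_def by (intro span_minimal gensU subspace_V)
  define L where "L = {X \<in> so_odd n. \<forall>u\<in>U. \<rho> X u \<in> U}"
  have LI: "X \<in> L" if "X \<in> so_odd n" "\<And>m x. x \<in> G m \<Longrightarrow> \<rho> X x \<in> U" for X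
    using act_span[OF that(1) subU gensU] that unfolding L_def U_def[symmetric] by auto
  have "L = so_odd n"
  proof (rule so_odd_generated)
    show "cartan n \<subseteq> L"
      by (intro subsetI LI cartan_so_odd) (use HG GU in blast)+
    show "chev_f n k \<in> L" if "k \<in> {1..n}" for k
      using fG[OF that] GU by (auto intro!: LI chev_in_so_odd that)
    show "chev_e n k \<in> L" if k: "k \<in> {1..n}" for k
    proof (rule LI[OF chev_in_so_odd(1)[OF k]])
      show "\<rho> (chev_e n k) x \<in> U" if "x \<in> G m" for m x
        using that eG0[OF k] eG[OF k] subspace_0[OF subU] GU by (cases m) (simp, blast)
    qed
    show "X + Y \<in> L" "lie_bracket X Y \<in> L" if "X \<in> L" "Y \<in> L" for X Y
      using that UV subU unfolding L_def
      by (auto simp: add_in_so_odd lie_bracket_in_so_odd add_act bracket_act subset_iff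
          intro!: subspace_add subspace_diff)
    show "c \<cdot>\<^sub>m X \<in> L" if "X \<in> L" for c X
      using that UV subU unfolding L_def
      by (auto simp: smult_in_so_odd smult_act subset_iff intro!: subspace_scale)
  qed (auto simp: L_def)
  then have "invariant_subspace n scl V \<rho> U"
    using UV subU by (auto simp: invariant_subspace_def L_def)
  moreover have "v \<in> U" using GU[of 0] G0 span_base by auto
  moreover have "\<exists>c. x = scl c v"
    if x: "x \<in> U" and ex: "\<rho> (height_mat n) x = scl (\<mu> (height_mat n)) x" for x
  proof -
    define D where "D = {x. \<exists>g M. (\<forall>m. g m \<in> G m) \<and> (\<forall>m\<ge>M. g m = 0) \<and> x = (\<Sum>m<M. g m)}"
    have "subspace D"
      unfolding subspace_def
    proof (intro conjI ballI allI)
      show "0 \<in> D"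
        using subspace_0[OF subG] by (auto simp: D_def intro!: exI[of _ "\<lambda>m. 0"] exI[of _ 0])
      fix x y assume "x \<in> D" "y \<in> D"
      then obtain g M g' M' where g: "\<forall>m. g m \<in> G m" "\<forall>m\<ge>M. g m = 0" "x = (\<Sum>m<M. g m)"
        and g': "\<forall>m. g' m \<in> G m" "\<forall>m\<ge>M'. g' m = 0" "y = (\<Sum>m<M'. g' m)"
        unfolding D_def by blast
      have "x = (\<Sum>m<max M M'. g m)" unfolding g(3)
        by (rule sum.mono_neutral_left) (use g(2) in auto)
      moreover have "y = (\<Sum>m<max M M'. g' m)" unfolding g'(3)
        by (rule sum.mono_neutral_left) (use g'(2) in auto)
      ultimately have "x + y = (\<Sum>m<max M M'. g m + g' m)" by (simp add: sum.distrib)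
      then show "x + y \<in> D" unfolding D_def
        using g(1,2) g'(1,2) subspace_add[OF subG]
        by (intro CollectI exI[of _ "\<lambda>m. g m + g' m"] exI[of _ "max M M'"]) auto
    next
      fix c x assume "x \<in> D"
      then obtain g M where g: "\<forall>m. g m \<in> G m" "\<forall>m\<ge>M. g m = 0" "x = (\<Sum>m<M. g m)"
        unfolding D_def by blast
      then show "scl c x \<in> D" unfolding D_def
        using subspace_scale[OF subG]
        by (intro CollectI exI[of _ "\<lambda>m. scl c (g m)"] exI[of _ M]) (auto simp: scale_sum_right)
    qed
    moreover have "G m \<subseteq> D" for m
    proof
      fix y assume "y \<in> G m"
      then show "y \<in> D" unfolding D_def
        using subspace_0[OF subG]
        by (intro CollectI exI[of _ "\<lambda>i. if i = m then y else 0"] exI[of _ "Suc m"]) auto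
    qed
    ultimately have "U \<subseteq> D" unfolding U_def by (intro span_minimal) auto
    then obtain g M where g: "\<And>m. g m \<in> G m" "\<And>m. m \<ge> M \<Longrightarrow> g m = 0" "x = (\<Sum>m<M. g m)"
      using x unfolding D_def by blast
    \<comment> \<open>\<open>x\<close> has the eigenvalue of \<open>g 0\<close>, so it is absorbed there to keep the eigenvalues distinct.\<close>
    define y where "y m = (if m = 0 then g 0 - x else g m)" for m
    have "g 0 - x \<in> {0}"
    proof -
      have xV: "x \<in> V" using x UV by auto
      have gV: "g m \<in> V" for m using g(1) GV by auto
      have "(\<Sum>m<Suc M. y m) = (\<Sum>m<Suc M. g m) - x"
        unfolding sum.lessThan_Suc_shift by (simp add: y_def)
      also have "\<dots> = 0" using g(2,3) by simp
      finally have sum0: "(\<Sum>m<Suc M. y m) \<in> {0}" by simp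
      have "y 0 \<in> {0}"
      proof (rule eigenvector_components[OF cartan_so_odd[OF height_mat_cartan] subspace_single_0, where
            F="{..<Suc M}" and a="\<lambda>m. \<mu> (height_mat n) - of_nat m"])
        show "y i \<in> V" for i unfolding y_def using gV xV subspace_V by (auto intro!: subspace_diff)
        show "\<rho> (height_mat n) (y i) = scl (\<mu> (height_mat n) - of_nat i) (y i)" for i
        proof (cases "i = 0")
          case True
          let ?E = "{x \<in> V. \<rho> (height_mat n) x = scl (\<mu> (height_mat n)) x}"
          have "g 0 - x \<in> ?E"
            by (intro subspace_diff subspace_eigenspace cartan_so_odd height_mat_cartan)
              (use heightG[OF g(1), of 0] gV xV ex in auto)
          then show ?thesis using True by (simp add: y_def)
        qed (use heightG[OF g(1)] y_def in auto)
      qed (use sum0 in \<open>auto simp: inj_on_def act_zero cartan_so_odd height_mat_cartan\<close>)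
      then show ?thesis by (simp add: y_def)
    qed
    then have "x \<in> G 0" using g(1)[of 0] by simp
    then show ?thesis by (auto simp: G0 span_singleton)
  qed
  ultimately show thesis by (rule that)
qed

section \<open>Uniqueness of irreducible highest weight representations\<close>

lemma so_rep_prod:
  assumes "so_rep n scl V \<rho>" "so_rep n scl' W \<sigma>"
  shows "so_rep n (\<lambda>c p. (scl c (fst p), scl' c (snd p))) (V \<times> W)
    (\<lambda>X p. (\<rho> X (fst p), \<sigma> X (snd p)))"
proof -
  interpret V: so_module n scl V \<rho> by unfold_locales (rule assms)
  interpret W: so_module n scl' W \<sigma> by unfold_locales (rule assms)
  interpret P: vector_space "\<lambda>c p. (scl c (fst p), scl' c (snd p))"
    by unfold_locales
      (simp_all add: V.scale_right_distrib W.scale_right_distrib V.scale_left_distrib W.scale_left_distrib)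
  have "P.subspace (V \<times> W)"
    using V.subspace_V W.subspace_V
    by (auto simp: P.subspace_def V.subspace_def W.subspace_def zero_prod_def)
  then show ?thesis
    unfolding so_rep_def
    by (auto simp: P.vector_space_axioms V.act_in W.act_in V.act_add W.act_add V.act_scale W.act_scale
        V.add_act W.add_act V.smult_act W.smult_act V.bracket_act W.bracket_act)
qed

text \<open>In the direct sum of two such representations, the highest weight vectors \<open>v\<close> and \<open>w\<close> form a
  highest weight vector \<open>(v,w)\<close>. The subrepresentation that it generates is the graph of an
  isomorphism: \<open>(v,0)\<close> is not in it because its top weight space is the line of \<open>(v,w)\<close>, so by
  irreducibility it meets \<open>V\<close> trivially, and likewise \<open>W\<close>, while it projects onto both.\<close>

lemma irreducible_hw_rep_unique:
  fixes scl :: "complex \<Rightarrow> 'v::ab_group_add \<Rightarrow> 'v" and scl' :: "complex \<Rightarrow> 'w::ab_group_add \<Rightarrow> 'w"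
  assumes "is_irreducible_hw_rep n \<mu> scl V \<rho>" "is_irreducible_hw_rep n \<mu> scl' W \<sigma>"
  shows "rep_isomorphic n scl V \<rho> scl' W \<sigma>"
proof -
  have Vrep: "so_rep n scl V \<rho>" and Wrep: "so_rep n scl' W \<sigma>"
    using assms by (auto simp: is_irreducible_hw_rep_def irreducible_rep_def)
  have Virr: "\<And>U. invariant_subspace n scl V \<rho> U \<Longrightarrow> U = {0} \<or> U = V"
    and Wirr: "\<And>U. invariant_subspace n scl' W \<sigma> U \<Longrightarrow> U = {0} \<or> U = W"
    using assms by (auto simp: is_irreducible_hw_rep_def irreducible_rep_def)
  interpret V: so_module n scl V \<rho> by unfold_locales (rule Vrep)
  interpret W: so_module n scl' W \<sigma> by unfold_locales (rule Wrep)
  define scl2 where "scl2 c p = (scl c (fst p), scl' c (snd p))" for c p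
  define \<tau> where "\<tau> X p = (\<rho> X (fst p), \<sigma> X (snd p))" for X p
  interpret P: so_module n scl2 "V \<times> W" \<tau>
    by unfold_locales (use so_rep_prod[OF Vrep Wrep] in \<open>simp add: scl2_def[abs_def] \<tau>_def[abs_def]\<close>)
  obtain v where v: "v \<in> V" "v \<noteq> 0" "\<And>k. k \<in> {1..n} \<Longrightarrow> \<rho> (chev_e n k) v = 0"
      "\<And>H. H \<in> cartan n \<Longrightarrow> \<rho> H v = scl (\<mu> H) v"
    and vgen: "\<And>U. invariant_subspace n scl V \<rho> U \<Longrightarrow> v \<in> U \<Longrightarrow> U = V"
    using assms(1) by (auto simp: is_irreducible_hw_rep_def highest_weight_rep_def)
  obtain w where w: "w \<in> W" "w \<noteq> 0" "\<And>k. k \<in> {1..n} \<Longrightarrow> \<sigma> (chev_e n k) w = 0"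
      "\<And>H. H \<in> cartan n \<Longrightarrow> \<sigma> H w = scl' (\<mu> H) w"
    and wgen: "\<And>U. invariant_subspace n scl' W \<sigma> U \<Longrightarrow> w \<in> U \<Longrightarrow> U = W"
    using assms(2) by (auto simp: is_irreducible_hw_rep_def highest_weight_rep_def)
  obtain U where U: "invariant_subspace n scl2 (V \<times> W) \<tau> U" "(v,w) \<in> U"
    and top: "\<And>x. x \<in> U \<Longrightarrow> \<tau> (height_mat n) x = scl2 (\<mu> (height_mat n)) x \<Longrightarrow> \<exists>c. x = scl2 c (v,w)"
    by (rule P.highest_weight_submodule[of "(v,w)" \<mu>])
      (use v w in \<open>auto simp: \<tau>_def scl2_def zero_prod_def\<close>)
  have UVW: "U \<subseteq> V \<times> W" and subU: "P.subspace U" and actU: "\<And>X u. X \<in> so_odd n \<Longrightarrow> u \<in> U \<Longrightarrow> \<tau> X u \<in> U"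
    using U(1) by (auto simp: invariant_subspace_def)
  have U0: "(0,0) \<in> U" using P.subspace_0[OF subU] by (simp add: zero_prod_def)
  have Uadd: "(a+a', b+b') \<in> U" if "(a,b) \<in> U" "(a',b') \<in> U" for a b a' b'
    using P.subspace_add[OF subU that] by simp
  have Uscl: "(scl c a, scl' c b) \<in> U" if "(a,b) \<in> U" for a b c
    using P.subspace_scale[OF subU that, of c] by (simp add: scl2_def)
  have Uact: "(\<rho> X a, \<sigma> X b) \<in> U" if "X \<in> so_odd n" "(a,b) \<in> U" for X a b
    using actU[OF that] by (simp add: \<tau>_def)
  note H = cartan_so_odd[OF height_mat_cartan, of n]
  have left: "a = 0" if "(a,0) \<in> U" for a
  proof -
    let ?K = "{a. (a,0) \<in> U}"
    have "invariant_subspace n scl V \<rho> ?K"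
      unfolding invariant_subspace_def V.subspace_def
      using UVW U0 Uadd[of _ 0 _ 0] Uscl[of _ 0] Uact[of _ _ 0] by (auto simp: W.act_zero)
    moreover have "v \<notin> ?K"
    proof
      assume "v \<in> ?K"
      then have "\<exists>c. (v,0) = scl2 c (v,w)"
        using v(4)[OF height_mat_cartan] by (intro top) (auto simp: \<tau>_def scl2_def W.act_zero H)
      then show False using v(2) w(2) by (auto simp: scl2_def)
    qed
    ultimately have "?K = {0}" using Virr[of ?K] v(1) by auto
    then show ?thesis using that by auto
  qed
  have right: "b = 0" if "(0,b) \<in> U" for b
  proof -
    let ?K = "{b. (0,b) \<in> U}"
    have "invariant_subspace n scl' W \<sigma> ?K"
      unfolding invariant_subspace_def W.subspace_def
      using UVW U0 Uadd[of 0 _ 0 _] Uscl[of 0 _] Uact[of _ 0 _] by (auto simp: V.act_zero)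
    moreover have "w \<notin> ?K"
    proof
      assume "w \<in> ?K"
      then have "\<exists>c. (0,w) = scl2 c (v,w)"
        using w(4)[OF height_mat_cartan] by (intro top) (auto simp: \<tau>_def scl2_def V.act_zero H)
      then show False using v(2) w(2) by (auto simp: scl2_def)
    qed
    ultimately have "?K = {0}" using Wirr[of ?K] w(1) by auto
    then show ?thesis using that by auto
  qed
  have Udiff: "(a-a', b-b') \<in> U" if "(a,b) \<in> U" "(a',b') \<in> U" for a b a' b'
    using P.subspace_diff[OF subU that] by simp
  have "invariant_subspace n scl V \<rho> (Domain U)"
    unfolding invariant_subspace_def V.subspace_def
  proof (intro conjI ballI allI)
    show "Domain U \<subseteq> V" using UVW by auto
    show "0 \<in> Domain U" using U0 by blast
    show "x + y \<in> Domain U" if "x \<in> Domain U" "y \<in> Domain U" for x y using that Uadd by blast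
    show "scl c x \<in> Domain U" if "x \<in> Domain U" for c x using that Uscl by blast
    show "\<rho> X x \<in> Domain U" if "X \<in> so_odd n" "x \<in> Domain U" for X x using that Uact by blast
  qed
  then have domU: "Domain U = V" using vgen U(2) by blast
  have "invariant_subspace n scl' W \<sigma> (Range U)"
    unfolding invariant_subspace_def W.subspace_def
  proof (intro conjI ballI allI)
    show "Range U \<subseteq> W" using UVW by auto
    show "0 \<in> Range U" using U0 by blast
    show "x + y \<in> Range U" if "x \<in> Range U" "y \<in> Range U" for x y using that Uadd by blast
    show "scl' c x \<in> Range U" if "x \<in> Range U" for c x using that Uscl by blast
    show "\<sigma> X x \<in> Range U" if "X \<in> so_odd n" "x \<in> Range U" for X x using that Uact by blast
  qed
  then have ranU: "Range U = W" using wgen U(2) by blast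
  define \<phi> where "\<phi> a = (THE b. (a,b) \<in> U)" for a
  have unique: "b = b'" if "(a,b) \<in> U" "(a,b') \<in> U" for a b b'
    using right[of "b - b'"] Udiff[OF that] by simp
  have \<phi>: "\<phi> a = b" if "(a,b) \<in> U" for a b
    unfolding \<phi>_def by (rule the_equality) (use that unique in auto)
  have \<phi>U: "(a, \<phi> a) \<in> U" if "a \<in> V" for a
  proof -
    obtain b where "(a,b) \<in> U" using \<open>a \<in> V\<close> domU by blast
    then show ?thesis using \<phi> by simp
  qed
  have "bij_betw \<phi> V W"
    unfolding bij_betw_def
  proof
    show "inj_on \<phi> V"
    proof (rule inj_onI)
      fix a a' assume "a \<in> V" "a' \<in> V" "\<phi> a = \<phi> a'"
      then show "a = a'" using Udiff[OF \<phi>U \<phi>U, of a a'] left[of "a - a'"] by simp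
    qed
    show "\<phi> ` V = W"
    proof (intro equalityI subsetI)
      fix b assume "b \<in> \<phi> ` V"
      then show "b \<in> W" using \<phi>U UVW by auto
    next
      fix b assume "b \<in> W"
      then obtain a where "(a,b) \<in> U" using ranU by blast
      then show "b \<in> \<phi> ` V" using \<phi> UVW by force
    qed
  qed
  then show ?thesis
    unfolding rep_isomorphic_def
    by (intro exI[of _ \<phi>] conjI ballI allI \<phi> Uadd Uscl Uact \<phi>U)
qed

section \<open>Representations from Clifford relations\<close>

lemma sum_reflect: "(\<Sum>l\<le>m. f (m - l)) = (\<Sum>l\<le>(m::nat). f l)"
  using sum.nat_diff_reindex[of f "Suc m"] by (simp add: lessThan_Suc_atMost)

text \<open>The standard construction of spin representations. Let \<open>\<gamma>\<^sub>0, \<dots>, \<gamma>\<^bsub>2n\<^esub>\<close> satisfy the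
  Clifford relations of the form that defines the Lie algebra. The commutator with
  \<open>\<Sum> X\<^sub>i\<^sub>j \<gamma>\<^sub>i \<gamma>\<^sub>j\<^sub>' / 4\<close> acts on the span of the \<open>\<gamma>\<^sub>k\<close> as \<open>X\<close> acts on the standard
  basis, and this makes the assignment a representation.\<close>

locale clifford_action = vector_space scl
  for scl :: "complex \<Rightarrow> 'v::ab_group_add \<Rightarrow> 'v" +
  fixes n :: nat and V :: "'v set" and g :: "nat \<Rightarrow> 'v \<Rightarrow> 'v"
  assumes V: "subspace V"
    and g_in: "i \<le> 2*n \<Longrightarrow> v \<in> V \<Longrightarrow> g i v \<in> V"
    and g_add: "i \<le> 2*n \<Longrightarrow> v \<in> V \<Longrightarrow> w \<in> V \<Longrightarrow> g i (v + w) = g i v + g i w"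
    and g_scale: "i \<le> 2*n \<Longrightarrow> v \<in> V \<Longrightarrow> g i (scl c v) = scl c (g i v)"
    and anticommute: "i \<le> 2*n \<Longrightarrow> j \<le> 2*n \<Longrightarrow> v \<in> V \<Longrightarrow>
      g i (g j v) + g j (g i v) = scl (if i + j = 2*n then 2 else 0) v"
begin

definition act :: "complex mat \<Rightarrow> 'v \<Rightarrow> 'v" where
  "act X v = scl (1/4) (\<Sum>i\<le>2*n. \<Sum>j\<le>2*n. scl (X $$ (i,j)) (g i (g (2*n-j) v)))"

lemma g_sum: "i \<le> 2*n \<Longrightarrow> (\<And>x. x \<in> F \<Longrightarrow> f x \<in> V) \<Longrightarrow> g i (\<Sum>x\<in>F. f x) = (\<Sum>x\<in>F. g i (f x))"
proof (induction F rule: infinite_finite_induct)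
  case (insert x F)
  then show ?case by (simp add: g_add subspace_sum[OF V])
qed (use g_scale[of i 0 0] subspace_0[OF V] in simp_all)

lemma act_in: "v \<in> V \<Longrightarrow> act X v \<in> V"
  unfolding act_def by (intro subspace_scale subspace_sum V g_in) auto

lemma act_add: "v \<in> V \<Longrightarrow> w \<in> V \<Longrightarrow> act X (v + w) = act X v + act X w"
  unfolding act_def by (simp add: g_add g_in scale_right_distrib sum.distrib)

lemma act_scale: "v \<in> V \<Longrightarrow> act X (scl c v) = scl c (act X v)"
  unfolding act_def by (simp add: g_scale g_in scale_sum_right mult.commute mult.left_commute)

lemma act_sum: "(\<And>x. x \<in> F \<Longrightarrow> f x \<in> V) \<Longrightarrow> act X (\<Sum>x\<in>F. f x) = (\<Sum>x\<in>F. act X (f x))"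
proof (induction F rule: infinite_finite_induct)
  case (insert x F)
  then show ?case by (simp add: act_add subspace_sum[OF V])
qed (use act_scale[of 0 X 0] subspace_0[OF V] in simp_all)

text \<open>Moving \<open>\<gamma>\<^sub>k\<close> through the two factors of each summand leaves two linear expressions in the
  generators. The symmetry that defines the Lie algebra makes them equal.\<close>

lemma act_g:
  assumes X: "X \<in> so_odd n" and k: "k \<le> 2*n" and v: "v \<in> V"
  shows "act X (g k v) = g k (act X v) + (\<Sum>i\<le>2*n. scl (X $$ (i,k)) (g i v))"
proof -
  have swap: "g i (g j u) = scl (if i + j = 2*n then 2 else 0) u - g j (g i u)"
    if "i \<le> 2*n" "j \<le> 2*n" "u \<in> V" for i j u
    using anticommute[OF that] by (simp add: algebra_simps)
  have triple: "g i (g (2*n-j) (g k v)) = g k (g i (g (2*n-j) v))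
      + scl (if j = k then 2 else 0) (g i v) - scl (if i = 2*n-k then 2 else 0) (g (2*n-j) v)"
    if "i \<le> 2*n" "j \<le> 2*n" for i j
  proof -
    have iff: "2*n-j + k = 2*n \<longleftrightarrow> j = k" "i + k = 2*n \<longleftrightarrow> i = 2*n-k" using that k by auto
    have gV: "g (2*n-j) v \<in> V" "g k (g (2*n-j) v) \<in> V" using v k by (simp_all add: g_in)
    have "g (2*n-j) (g k v) = scl (if j = k then 2 else 0) v + scl (-1) (g k (g (2*n-j) v))"
      using swap[of "2*n-j" k v] k v iff by simp
    then have "g i (g (2*n-j) (g k v))
        = g i (scl (if j = k then 2 else 0) v + scl (-1) (g k (g (2*n-j) v)))"
      by (rule arg_cong)
    also have "\<dots> = scl (if j = k then 2 else 0) (g i v) + scl (-1) (g i (g k (g (2*n-j) v)))"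
      using gV v that by (simp only: g_add g_scale subspace_scale[OF V])
    also have "g i (g k (g (2*n-j) v)) = scl (if i = 2*n-k then 2 else 0) (g (2*n-j) v)
        - g k (g i (g (2*n-j) v))"
      using swap[OF that(1) k gV(1)] iff by simp
    finally show ?thesis by simp
  qed
  have delta1: "scl x (scl (if j = k then 2 else 0) u) = (if j = k then scl (2*x) u else 0)" for x j u
    by (simp add: mult.commute)
  have delta2: "scl x (scl (if i = 2*n-k then 2 else 0) u) = (if i = 2*n-k then scl (2*x) u else 0)" for x i u
    by (simp add: mult.commute)
  have "(\<Sum>i\<le>2*n. \<Sum>j\<le>2*n. scl (X $$ (i,j)) (g i (g (2*n-j) (g k v))))
      = (\<Sum>i\<le>2*n. \<Sum>j\<le>2*n. scl (X $$ (i,j)) (g k (g i (g (2*n-j) v)))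
          + (if j = k then scl (2 * X $$ (i,j)) (g i v) else 0)
          - (if i = 2*n-k then scl (2 * X $$ (i,j)) (g (2*n-j) v) else 0))"
    by (intro sum.cong refl)
      (simp only: triple atMost_iff scale_right_distrib scale_right_diff_distrib delta1 delta2)
  also have "\<dots> = (\<Sum>i\<le>2*n. \<Sum>j\<le>2*n. scl (X $$ (i,j)) (g k (g i (g (2*n-j) v))))
        + (\<Sum>i\<le>2*n. \<Sum>j\<le>2*n. if j = k then scl (2 * X $$ (i,j)) (g i v) else 0)
        - (\<Sum>i\<le>2*n. \<Sum>j\<le>2*n. if i = 2*n-k then scl (2 * X $$ (i,j)) (g (2*n-j) v) else 0)"
    by (simp only: sum.distrib sum_subtractf)
  also have "(\<Sum>i\<le>2*n. \<Sum>j\<le>2*n. if j = k then scl (2 * X $$ (i,j)) (g i v) else 0)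
      = scl 2 (\<Sum>i\<le>2*n. scl (X $$ (i,k)) (g i v))"
    using k by (simp add: scale_sum_right)
  also have "(\<Sum>i\<le>2*n. \<Sum>j\<le>2*n. if i = 2*n-k then scl (2 * X $$ (i,j)) (g (2*n-j) v) else 0)
      = (\<Sum>j\<le>2*n. \<Sum>i\<le>2*n. if i = 2*n-k then scl (2 * X $$ (i,j)) (g (2*n-j) v) else 0)"
    by (rule sum.swap)
  also have "\<dots> = (\<Sum>j\<le>2*n. scl (2 * X $$ (2*n-k,j)) (g (2*n-j) v))"
    by simp
  also have "\<dots> = (\<Sum>j\<le>2*n. scl (2 * X $$ (2*n-k,2*n-j)) (g j v))"
    using sum_reflect[of "\<lambda>j. scl (2 * X $$ (2*n-k,2*n-j)) (g j v)" "2*n"] by simp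
  also have "\<dots> = - scl 2 (\<Sum>i\<le>2*n. scl (X $$ (i,k)) (g i v))"
    unfolding scale_sum_right sum_negf[symmetric]
    by (rule sum.cong) (use k in \<open>simp_all add: so_odd_entry[OF X]\<close>)
  also have "(\<Sum>i\<le>2*n. \<Sum>j\<le>2*n. scl (X $$ (i,j)) (g k (g i (g (2*n-j) v))))
      = g k (\<Sum>i\<le>2*n. \<Sum>j\<le>2*n. scl (X $$ (i,j)) (g i (g (2*n-j) v)))"
  proof -
    have in_V: "scl c (g i (g (2*n-j) v)) \<in> V" if "i \<in> {..2*n}" for c i j
      using that v by (intro subspace_scale V g_in) auto
    have "g k (\<Sum>i\<le>2*n. \<Sum>j\<le>2*n. scl (X $$ (i,j)) (g i (g (2*n-j) v)))
        = (\<Sum>i\<le>2*n. g k (\<Sum>j\<le>2*n. scl (X $$ (i,j)) (g i (g (2*n-j) v))))"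
      by (intro g_sum k subspace_sum V in_V)
    also have "\<dots> = (\<Sum>i\<le>2*n. \<Sum>j\<le>2*n. g k (scl (X $$ (i,j)) (g i (g (2*n-j) v))))"
      by (intro sum.cong refl g_sum k in_V)
    also have "\<dots> = (\<Sum>i\<le>2*n. \<Sum>j\<le>2*n. scl (X $$ (i,j)) (g k (g i (g (2*n-j) v))))"
      using v by (intro sum.cong refl g_scale k g_in) auto
    finally show ?thesis by (rule sym)
  qed
  finally have sum_eq: "(\<Sum>i\<le>2*n. \<Sum>j\<le>2*n. scl (X $$ (i,j)) (g i (g (2*n-j) (g k v))))
      = g k (\<Sum>i\<le>2*n. \<Sum>j\<le>2*n. scl (X $$ (i,j)) (g i (g (2*n-j) v)))
        + scl 4 (\<Sum>i\<le>2*n. scl (X $$ (i,k)) (g i v))"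
    by (simp add: scale_left_distrib[of 2 2, simplified])
  show ?thesis
  proof -
    have "(\<Sum>i\<le>2*n. \<Sum>j\<le>2*n. scl (X $$ (i,j)) (g i (g (2*n-j) v))) \<in> V"
      using v by (intro subspace_sum subspace_scale V g_in) auto
    then show ?thesis
      using sum_eq by (simp add: act_def scale_right_distrib g_scale[OF k])
  qed
qed

text \<open>With the previous lemma the commutator acts on each product \<open>\<gamma>\<^sub>i \<gamma>\<^sub>j\<^sub>'\<close> as a derivation. The
  derivative of the first factor yields the entries of \<open>X Y\<close>, and that of the second, after reflecting
  its summation index, those of \<open>- Y X\<close>.\<close>

lemma act_bracket:
  assumes X: "X \<in> so_odd n" and Y: "Y \<in> so_odd n" and v: "v \<in> V"
  shows "act (lie_bracket X Y) v = act X (act Y v) - act Y (act X v)"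
proof -
  have inner: "act X (g i (g (2*n-j) v)) = g i (g (2*n-j) (act X v))
      + (\<Sum>l\<le>2*n. scl (X $$ (l,i)) (g l (g (2*n-j) v)))
      - (\<Sum>l\<le>2*n. scl (X $$ (j,l)) (g i (g (2*n-l) v)))"
    if "i \<le> 2*n" "j \<le> 2*n" for i j
  proof -
    have j': "2*n-j \<le> 2*n" by simp
    have "act X (g (2*n-j) v) = g (2*n-j) (act X v) + (\<Sum>l\<le>2*n. scl (X $$ (l,2*n-j)) (g l v))"
      by (rule act_g[OF X j' v])
    also have "(\<Sum>l\<le>2*n. scl (X $$ (l,2*n-j)) (g l v))
        = (\<Sum>l\<le>2*n. scl (X $$ (2*n-l,2*n-j)) (g (2*n-l) v))"
      by (rule sum_reflect[symmetric])
    also have "\<dots> = (\<Sum>l\<le>2*n. scl (- X $$ (j,l)) (g (2*n-l) v))"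
      by (rule sum.cong) (use that in \<open>simp_all add: so_odd_entry[OF X]\<close>)
    finally have "g i (act X (g (2*n-j) v)) = g i (g (2*n-j) (act X v))
        + g i (\<Sum>l\<le>2*n. scl (- X $$ (j,l)) (g (2*n-l) v))"
      using that v by (simp only: g_add act_in g_in j' subspace_sum[OF V] subspace_scale[OF V] diff_le_self)
    also have "g i (\<Sum>l\<le>2*n. scl (- X $$ (j,l)) (g (2*n-l) v))
        = (\<Sum>l\<le>2*n. scl (- X $$ (j,l)) (g i (g (2*n-l) v)))"
      using that v by (simp only: g_sum g_scale g_in subspace_scale[OF V] diff_le_self)
    finally show ?thesis
      using act_g[OF X that(1) g_in[OF j' v]] by (simp add: sum_negf algebra_simps)
  qed
  have XY_commute: "X $$ p * Y $$ q = Y $$ q * X $$ p" for p q by (rule mult.commute)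
  have in_V: "scl c (g i (g (2*n-j) v)) \<in> V" if "i \<in> {..2*n}" for c i j
    using that v by (intro subspace_scale V g_in) auto
  have "act X (act Y v)
      = scl (1/4) (act X (\<Sum>i\<le>2*n. \<Sum>j\<le>2*n. scl (Y $$ (i,j)) (g i (g (2*n-j) v))))"
    unfolding act_def[of Y] by (intro act_scale subspace_sum V in_V)
  also have "act X (\<Sum>i\<le>2*n. \<Sum>j\<le>2*n. scl (Y $$ (i,j)) (g i (g (2*n-j) v)))
      = (\<Sum>i\<le>2*n. act X (\<Sum>j\<le>2*n. scl (Y $$ (i,j)) (g i (g (2*n-j) v))))"
    by (intro act_sum subspace_sum V in_V)
  also have "\<dots> = (\<Sum>i\<le>2*n. \<Sum>j\<le>2*n. act X (scl (Y $$ (i,j)) (g i (g (2*n-j) v))))"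
    by (intro sum.cong refl act_sum in_V)
  also have "\<dots> = (\<Sum>i\<le>2*n. \<Sum>j\<le>2*n. scl (Y $$ (i,j)) (act X (g i (g (2*n-j) v))))"
    using v by (intro sum.cong refl act_scale g_in) auto
  also have "(\<Sum>i\<le>2*n. \<Sum>j\<le>2*n. scl (Y $$ (i,j)) (act X (g i (g (2*n-j) v))))
    = (\<Sum>i\<le>2*n. \<Sum>j\<le>2*n. scl (Y $$ (i,j)) (g i (g (2*n-j) (act X v)))
        + (\<Sum>l\<le>2*n. scl (X $$ (l,i) * Y $$ (i,j)) (g l (g (2*n-j) v)))
        - (\<Sum>l\<le>2*n. scl (Y $$ (i,j) * X $$ (j,l)) (g i (g (2*n-l) v))))"
    by (intro sum.cong refl)
      (simp add: inner scale_right_distrib scale_right_diff_distrib scale_sum_right XY_commute)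
  also have "\<dots> = (\<Sum>i\<le>2*n. \<Sum>j\<le>2*n. scl (Y $$ (i,j)) (g i (g (2*n-j) (act X v))))
      + (\<Sum>i\<le>2*n. \<Sum>j\<le>2*n. \<Sum>l\<le>2*n. scl (X $$ (l,i) * Y $$ (i,j)) (g l (g (2*n-j) v)))
      - (\<Sum>i\<le>2*n. \<Sum>j\<le>2*n. \<Sum>l\<le>2*n. scl (Y $$ (i,j) * X $$ (j,l)) (g i (g (2*n-l) v)))"
    by (simp only: sum.distrib sum_subtractf)
  also have "(\<Sum>i\<le>2*n. \<Sum>j\<le>2*n. \<Sum>l\<le>2*n. scl (X $$ (l,i) * Y $$ (i,j)) (g l (g (2*n-j) v)))
      = (\<Sum>i\<le>2*n. \<Sum>l\<le>2*n. \<Sum>j\<le>2*n. scl (X $$ (l,i) * Y $$ (i,j)) (g l (g (2*n-j) v)))"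
    by (rule sum.cong[OF refl sum.swap])
  also have "\<dots> = (\<Sum>l\<le>2*n. \<Sum>i\<le>2*n. \<Sum>j\<le>2*n. scl (X $$ (l,i) * Y $$ (i,j)) (g l (g (2*n-j) v)))"
    by (rule sum.swap)
  also have "\<dots> = (\<Sum>l\<le>2*n. \<Sum>j\<le>2*n. \<Sum>i\<le>2*n. scl (X $$ (l,i) * Y $$ (i,j)) (g l (g (2*n-j) v)))"
    by (rule sum.cong[OF refl sum.swap])
  also have "(\<Sum>i\<le>2*n. \<Sum>j\<le>2*n. \<Sum>l\<le>2*n. scl (Y $$ (i,j) * X $$ (j,l)) (g i (g (2*n-l) v)))
      = (\<Sum>i\<le>2*n. \<Sum>l\<le>2*n. \<Sum>j\<le>2*n. scl (Y $$ (i,j) * X $$ (j,l)) (g i (g (2*n-l) v)))"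
    by (rule sum.cong[OF refl sum.swap])
  finally have "act X (act Y v) = act Y (act X v)
      + scl (1/4) ((\<Sum>a\<le>2*n. \<Sum>b\<le>2*n. \<Sum>l\<le>2*n. scl (X $$ (a,l) * Y $$ (l,b)) (g a (g (2*n-b) v)))
        - (\<Sum>a\<le>2*n. \<Sum>b\<le>2*n. \<Sum>l\<le>2*n. scl (Y $$ (a,l) * X $$ (l,b)) (g a (g (2*n-b) v))))"
    unfolding act_def[of Y "act X v"] by (simp add: scale_right_distrib scale_right_diff_distrib)
  moreover have "act (lie_bracket X Y) v = scl (1/4)
       ((\<Sum>a\<le>2*n. \<Sum>b\<le>2*n. \<Sum>l\<le>2*n. scl (X $$ (a,l) * Y $$ (l,b)) (g a (g (2*n-b) v)))
        - (\<Sum>a\<le>2*n. \<Sum>b\<le>2*n. \<Sum>l\<le>2*n. scl (Y $$ (a,l) * X $$ (l,b)) (g a (g (2*n-b) v))))"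
    unfolding act_def sum_subtractf[symmetric]
    by (intro arg_cong[where f="scl (1/4)"] sum.cong refl)
      (simp add: lie_bracket_entry[OF X Y] scale_left_diff_distrib scale_sum_left sum_subtractf)
  ultimately show ?thesis by simp
qed

theorem so_rep_act: "so_rep n scl V act"
  unfolding so_rep_def
proof (intro conjI ballI allI)
  fix X Y v c assume XY: "X \<in> so_odd n" "Y \<in> so_odd n" and v: "v \<in> V"
  show "act (X + Y) v = act X v + act Y v"
    unfolding act_def using so_odd_carrier[OF XY(1)] so_odd_carrier[OF XY(2)]
    by (simp add: scale_left_distrib sum.distrib scale_right_distrib)
next
  fix X v c assume X: "X \<in> so_odd n" and v: "v \<in> V"
  show "act (c \<cdot>\<^sub>m X) v = scl c (act X v)"
    unfolding act_def using so_odd_carrier[OF X]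
    by (simp add: scale_sum_right mult.commute mult.left_commute)
qed (use V vector_space_axioms act_in act_add act_scale act_bracket in auto)

lemma act_root_mat:
  assumes ij: "i \<le> 2*n" "j \<le> 2*n" "i \<noteq> j" and v: "v \<in> V"
  shows "act (root_mat n i j) v = scl (1/2) (g i (g (2*n-j) v))"
proof -
  have "(\<Sum>a\<le>2*n. \<Sum>b\<le>2*n. scl (root_mat n i j $$ (a,b)) (g a (g (2*n-b) v)))
    = (\<Sum>a\<le>2*n. \<Sum>b\<le>2*n. (if b = j then if a = i then g a (g (2*n-b) v) else 0 else 0)
        - (if b = 2*n-i then if a = 2*n-j then g a (g (2*n-b) v) else 0 else 0))"
    by (intro sum.cong refl) (simp add: root_mat_entry scale_left_diff_distrib)
  also have "\<dots> = g i (g (2*n-j) v) - g (2*n-j) (g i v)"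
    using ij by (simp add: sum_subtractf)
  also have "\<dots> = scl 2 (g i (g (2*n-j) v))"
  proof -
    have "i + (2*n-j) \<noteq> 2*n" using ij by linarith
    then have "g i (g (2*n-j) v) + g (2*n-j) (g i v) = 0"
      using anticommute[of i "2*n-j" v] ij v by (simp only: diff_le_self if_False scale_zero_left)
    then have "g (2*n-j) (g i v) = - g i (g (2*n-j) v)"
      by (simp add: eq_neg_iff_add_eq_0 add.commute)
    then show ?thesis
      using scale_left_distrib[of 1 1 "g i (g (2*n-j) v)"] by simp
  qed
  finally show ?thesis by (simp add: act_def)
qed

text \<open>The middle diagonal entry of \<open>H\<close> is zero and the entries at \<open>i\<close> and \<open>i'\<close> are opposite, so
  each \<open>i < n\<close> contributes a commutator.\<close>

lemma act_cartan:
  assumes H: "H \<in> cartan n" and v: "v \<in> V"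
  shows "act H v = scl (1/4) (\<Sum>i<n. scl (H $$ (i,i)) (g i (g (2*n-i) v) - g (2*n-i) (g i v)))"
proof -
  have "(\<Sum>a\<le>2*n. \<Sum>b\<le>2*n. scl (H $$ (a,b)) (g a (g (2*n-b) v)))
      = (\<Sum>a\<le>2*n. \<Sum>b\<le>2*n. if b = a then scl (H $$ (a,a)) (g a (g (2*n-a) v)) else 0)"
    by (intro sum.cong refl) (auto simp: cartan_off_diagonal[OF H])
  also have "\<dots> = (\<Sum>a\<le>2*n. scl (H $$ (a,a)) (g a (g (2*n-a) v)))" by simp
  also have "\<dots> = (\<Sum>a\<in>{..<n} \<union> {n} \<union> {n<..2*n}. scl (H $$ (a,a)) (g a (g (2*n-a) v)))"
    by (rule sum.cong) auto
  also have "\<dots> = (\<Sum>a<n. scl (H $$ (a,a)) (g a (g (2*n-a) v))) + scl (H $$ (n,n)) (g n (g n v))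
      + (\<Sum>a\<in>{n<..2*n}. scl (H $$ (a,a)) (g a (g (2*n-a) v)))"
    by (subst sum.union_disjoint; simp?) (auto simp: add.commute)
  also have "H $$ (n,n) = 0"
    using so_odd_entry[OF cartan_so_odd[OF H], of n n] by simp
  also have "(\<Sum>a\<in>{n<..2*n}. scl (H $$ (a,a)) (g a (g (2*n-a) v)))
      = (\<Sum>a<n. scl (H $$ (2*n-a,2*n-a)) (g (2*n-a) (g a v)))"
    by (rule sum.reindex_bij_witness[of _ "\<lambda>a. 2*n-a" "\<lambda>a. 2*n-a"]) auto
  also have "\<dots> = (\<Sum>a<n. - scl (H $$ (a,a)) (g (2*n-a) (g a v)))"
    by (rule sum.cong) (simp_all add: so_odd_entry[OF cartan_so_odd[OF H]])
  finally show ?thesis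
    unfolding act_def by (simp add: scale_right_diff_distrib sum_subtractf sum_negf)
qed

end

section \<open>Self-conjugate diagrams as subsets\<close>

lemma down_closed_eq_interval:
  assumes "finite D" "\<And>x. x \<in> D \<Longrightarrow> 1 \<le> x" "\<And>x y. x \<in> D \<Longrightarrow> 1 \<le> y \<Longrightarrow> y \<le> x \<Longrightarrow> y \<in> D"
  shows "D = {1..card D :: nat}"
proof (cases "D = {}")
  case False
  have "D \<subseteq> {1..Max D}" using assms(2) Max_ge[OF assms(1)] by fastforce
  moreover have "{1..Max D} \<subseteq> D"
  proof
    fix y assume "y \<in> {1..Max D}"
    then show "y \<in> D" using assms(3)[OF Max_in[OF assms(1) False], of y] by simp
  qed
  ultimately have "D = {1..Max D}" by (rule subset_antisym)
  then show ?thesis by (metis card_atLeastAtMost diff_Suc_1)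
qed simp

lemma in_young_iff:
  "Y \<in> young n \<longleftrightarrow> Y \<subseteq> {1..n} \<times> {1..n} \<and>
     (\<forall>r s r' s'. (r,s) \<in> Y \<longrightarrow> 1 \<le> r' \<longrightarrow> r' \<le> r \<longrightarrow> 1 \<le> s' \<longrightarrow> s' \<le> s \<longrightarrow> (r',s') \<in> Y)"
  (is "_ \<longleftrightarrow> ?box \<and> ?down")
proof
  assume "Y \<in> young n"
  then obtain p where Y: "Y = {(r,s). r \<in> {1..n} \<and> s \<in> {1..p r}}"
    and p: "\<forall>r\<in>{1..n}. p r \<le> n" "\<forall>r\<in>{1..n}. \<forall>r'\<in>{1..n}. r \<le> r' \<longrightarrow> p r' \<le> p r"
    unfolding young_def by blast
  have "(r',s') \<in> Y" if "(r,s) \<in> Y" "1 \<le> r'" "r' \<le> r" "1 \<le> s'" "s' \<le> s" for r s r' s'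
  proof -
    have "r \<in> {1..n}" "s \<le> p r" "r' \<in> {1..n}" using that Y by auto
    moreover from this have "p r \<le> p r'" using p(2) that by blast
    ultimately show ?thesis using that Y by auto
  qed
  moreover have ?box using Y p(1) by fastforce
  ultimately show "?box \<and> ?down" by blast
next
  assume *: "?box \<and> ?down"
  then have box: ?box and down: "\<And>r s r' s'. (r,s) \<in> Y \<Longrightarrow> 1 \<le> r' \<Longrightarrow> r' \<le> r \<Longrightarrow> 1 \<le> s' \<Longrightarrow> s' \<le> s \<Longrightarrow> (r',s') \<in> Y"
    by blast+
  define p where "p r = card {s. (r,s) \<in> Y}" for r
  have fin: "finite {s. (r,s) \<in> Y}" for r
    by (rule finite_subset[of _ "{1..n}"]) (use box in auto)
  have row: "{s. (r,s) \<in> Y} = {1..p r}" for r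
    unfolding p_def
  proof (rule down_closed_eq_interval[OF fin])
    show "1 \<le> s" if "s \<in> {s. (r,s) \<in> Y}" for s using that box by auto
    show "t \<in> {s. (r,s) \<in> Y}" if "s \<in> {s. (r,s) \<in> Y}" "1 \<le> t" "t \<le> s" for s t
      using that down[of r s r t] box by auto
  qed
  have "Y = {(r,s). r \<in> {1..n} \<and> s \<in> {1..p r}}"
    using row box by blast
  moreover have "\<forall>r\<in>{1..n}. p r \<le> n"
  proof
    fix r
    have "p r \<le> card {1..n}"
      unfolding p_def by (rule card_mono) (use box in auto)
    then show "p r \<le> n" by simp
  qed
  moreover have "\<forall>r\<in>{1..n}. \<forall>r'\<in>{1..n}. r \<le> r' \<longrightarrow> p r' \<le> p r"
  proof (intro ballI impI)
    fix r r' assume "r \<in> {1..n}" "r' \<in> {1..n}" "r \<le> r'"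
    then have "{s. (r',s) \<in> Y} \<subseteq> {s. (r,s) \<in> Y}" using down box by fastforce
    then show "p r' \<le> p r" unfolding p_def by (rule card_mono[OF fin])
  qed
  ultimately show "Y \<in> young n" unfolding young_def by blast
qed

lemma young_box: "Y \<in> young n \<Longrightarrow> (r,s) \<in> Y \<Longrightarrow> 1 \<le> r \<and> r \<le> n \<and> 1 \<le> s \<and> s \<le> n"
  by (auto simp: in_young_iff)

lemma young_down:
  "Y \<in> young n \<Longrightarrow> (r,s) \<in> Y \<Longrightarrow> 1 \<le> r' \<Longrightarrow> r' \<le> r \<Longrightarrow> 1 \<le> s' \<Longrightarrow> s' \<le> s \<Longrightarrow> (r',s') \<in> Y"
  by (auto simp: in_young_iff)

lemma young_finite: "Y \<in> young n \<Longrightarrow> finite Y"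
  by (rule finite_subset[of _ "{1..n} \<times> {1..n}"]) (auto simp: in_young_iff)

definition diag_count :: "nat \<Rightarrow> diagram \<Rightarrow> nat \<Rightarrow> nat" where
  "diag_count n Y d = card {b \<in> Y. box_degree n b = d}"

text \<open>The boxes of a given degree form an initial segment of a diagonal, so their number determines
  them. Because of truncated subtraction, \<open>(t + (n-d), t + (d-n))\<close> is the \<open>t\<close>-th box of degree \<open>d\<close> on
  either side of the main diagonal.\<close>

lemma diagonal_mem_iff:
  assumes Y: "Y \<in> young n" and t: "1 \<le> t"
  shows "(t + (n-d), t + (d-n)) \<in> Y \<longleftrightarrow> t \<le> diag_count n Y d"
proof -
  define D where "D = {t. 1 \<le> t \<and> (t + (n-d), t + (d-n)) \<in> Y}"
  define h where "h t = (t + (n-d), t + (d-n))" for t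
  have "finite D"
    by (rule finite_subset[of _ "{..n}"]) (use young_box[OF Y] in \<open>force simp: D_def\<close>)+
  then have D: "D = {1..card D}"
  proof (rule down_closed_eq_interval)
    fix x y assume "x \<in> D" "1 \<le> y" "y \<le> x"
    then show "y \<in> D" unfolding D_def
      using young_down[OF Y, of "x + (n-d)" "x + (d-n)" "y + (n-d)" "y + (d-n)"] by simp
  qed (simp add: D_def)
  have "{b \<in> Y. box_degree n b = d} = h ` D"
  proof (intro equalityI subsetI)
    fix b assume b: "b \<in> {b \<in> Y. box_degree n b = d}"
    obtain r s where rs: "b = (r,s)" by (cases b)
    have "1 \<le> r" "r \<le> n" "1 \<le> s" "s \<le> n" and deg: "n + s - r = d"
      using b rs young_box[OF Y, of r s] by (auto simp: box_degree_def)
    then have "r = min r s + (n-d)" "s = min r s + (d-n)" "1 \<le> min r s" by linarith+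
    then have "b = h (min r s)" "min r s \<in> D"
      using b rs by (auto simp: h_def D_def)
    then show "b \<in> h ` D" by blast
  next
    fix b assume "b \<in> h ` D"
    then obtain u where u: "b = (u + (n-d), u + (d-n))" "u \<in> D" unfolding h_def by blast
    then have "b \<in> Y" by (simp add: D_def)
    moreover have "box_degree n b = d"
      using young_box[OF Y, of "u + (n-d)" "u + (d-n)"] u \<open>b \<in> Y\<close> by (simp add: box_degree_def)
    ultimately show "b \<in> {b \<in> Y. box_degree n b = d}" by simp
  qed
  moreover have "inj_on h D" by (auto simp: h_def inj_on_def)
  ultimately have "diag_count n Y d = card D"
    by (simp add: diag_count_def card_image)
  then have "t \<le> diag_count n Y d \<longleftrightarrow> t \<in> D" using D t by (metis atLeastAtMost_iff)
  then show ?thesis using t by (simp add: D_def)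
qed

text \<open>Reflection in the main diagonal exchanges the degrees \<open>d\<close> and \<open>2n - d\<close>, and a diagram is determined
  by its diagonal counts.\<close>

lemma sc_young_iff_diag_count:
  "Y \<in> sc_young n \<longleftrightarrow> Y \<in> young n \<and> (\<forall>d\<le>2*n. diag_count n Y (2*n-d) = diag_count n Y d)"
proof
  assume "Y \<in> sc_young n"
  then have Y: "Y \<in> young n" and conj: "Y\<inverse> = Y" by (auto simp: sc_young_def)
  have "diag_count n Y (2*n-d) = diag_count n Y d" if d: "d \<le> 2*n" for d
    unfolding diag_count_def
  proof (rule bij_betw_same_card[of prod.swap], rule bij_betw_byWitness[where f'=prod.swap])
    have "prod.swap b \<in> Y \<and> box_degree n (prod.swap b) + box_degree n b = 2*n" if "b \<in> Y" for b
    proof -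
      obtain r s where rs: "b = (r,s)" by (cases b)
      have "(s,r) \<in> Y" using that conj rs by blast
      moreover have "box_degree n (s,r) + box_degree n (r,s) = 2*n"
        using young_box[OF Y, of r s] that rs by (auto simp: box_degree_def)
      ultimately show ?thesis using rs by simp
    qed
    then show "prod.swap ` {b \<in> Y. box_degree n b = 2*n-d} \<subseteq> {b \<in> Y. box_degree n b = d}"
      "prod.swap ` {b \<in> Y. box_degree n b = d} \<subseteq> {b \<in> Y. box_degree n b = 2*n-d}"
      using d by fastforce+
  qed auto
  then show "Y \<in> young n \<and> (\<forall>d\<le>2*n. diag_count n Y (2*n-d) = diag_count n Y d)" using Y by blast
next
  assume *: "Y \<in> young n \<and> (\<forall>d\<le>2*n. diag_count n Y (2*n-d) = diag_count n Y d)"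
  then have Y: "Y \<in> young n" by blast
  have "(s,r) \<in> Y" if rs: "(r,s) \<in> Y" for r s
  proof -
    define d where "d = n + s - r"
    have b: "1 \<le> r" "r \<le> n" "1 \<le> s" "s \<le> n" using young_box[OF Y rs] by auto
    have d: "d \<le> 2*n" "(r,s) = (min r s + (n-d), min r s + (d-n))"
      "(s,r) = (min r s + (n-(2*n-d)), min r s + ((2*n-d)-n))" "1 \<le> min r s"
      using b unfolding d_def by auto
    show ?thesis
      using rs * d(1) unfolding d(3) diagonal_mem_iff[OF Y d(4)] 
      by (subst (asm) d(2)) (simp add: diagonal_mem_iff[OF Y d(4)])
  qed
  then show "Y \<in> sc_young n" using Y by (auto simp: sc_young_def)
qed

lemma sc_mem_iff:
  assumes Y: "Y \<in> sc_young n" and rs: "1 \<le> r" "r \<le> n" "1 \<le> s" "s \<le> n"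
  shows "(r,s) \<in> Y \<longleftrightarrow> min r s \<le> diag_count n Y (n - (max r s - min r s))"
proof -
  have Yy: "Y \<in> young n" and conj: "(a,b) \<in> Y \<longleftrightarrow> (b,a) \<in> Y" for a b
    using Y by (auto simp: sc_young_def)
  have lower: "(r,s) \<in> Y \<longleftrightarrow> s \<le> diag_count n Y (n - (r - s))" if "s \<le> r" "1 \<le> s" "r \<le> n" for r s
  proof -
    have "(r,s) = (s + (n - (n - (r-s))), s + ((n - (r-s)) - n))" using that by auto
    then show ?thesis using diagonal_mem_iff[OF Yy that(2), of "n - (r-s)"] by simp
  qed
  show ?thesis
  proof (cases "s \<le> r")
    case True
    then show ?thesis using lower[of s r] rs by (simp add: min_def max_def)
  next
    case False
    then show ?thesis using lower[of r s] rs conj[of r s] by (simp add: min_def max_def)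
  qed
qed

definition below :: "nat set \<Rightarrow> nat \<Rightarrow> nat" where
  "below S k = card (S \<inter> {..<k})"

lemma below_0 [simp]: "below S 0 = 0"
  by (simp add: below_def)

lemma below_Suc: "below S (Suc k) = below S k + (if k \<in> S then 1 else 0)"
  by (simp add: below_def lessThan_Suc)

text \<open>Moving away from the main diagonal by one step shortens a diagonal of the diagram by at most one
  box; this is what makes \<open>sc_diagram\<close> below a Young diagram.\<close>

lemma below_lipschitz: "k \<le> k' \<Longrightarrow> below S k \<le> below S k' \<and> below S k' \<le> below S k + (k' - k)"
  by (induction k' rule: dec_induct) (auto simp: below_Suc)

lemma below_le: "below S k \<le> k"
  using below_lipschitz[of 0 k S] by simp

text \<open>The diagonal of degree \<open>k \<le> n\<close> gets as many boxes as \<open>S\<close> has elements below \<open>k\<close>. Equivalently,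
  each element \<open>i\<close> of \<open>S\<close> is a hook with corner on the main diagonal and arm and leg length
  \<open>n - 1 - i\<close>.\<close>

definition sc_diagram :: "nat \<Rightarrow> nat set \<Rightarrow> diagram" where
  "sc_diagram n S = {(r,s). r \<in> {1..n} \<and> s \<in> {1..n} \<and>
     min r s \<le> below S (n - (max r s - min r s))}"

lemma sc_diagram_sc_young: "sc_diagram n S \<in> sc_young n"
proof -
  have "(r',s') \<in> sc_diagram n S"
    if "(r,s) \<in> sc_diagram n S" and le: "1 \<le> r'" "r' \<le> r" "1 \<le> s'" "s' \<le> s" for r s r' s'
  proof -
    define d d' where dd: "d = max r s - min r s" "d' = max r' s' - min r' s'"
    have rs: "r \<le> n" "s \<le> n" and m: "min r s \<le> below S (n - d)"
      using that by (auto simp: sc_diagram_def dd)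
    have mm: "min r' s' \<le> min r s" "max r' s' \<le> max r s" "max r s \<le> n" using le rs by auto
    have md: "min r s + d = max r s" "min r' s' + d' = max r' s'" by (auto simp: dd)
    have "min r' s' \<le> below S (n - d')"
    proof (cases "d' \<le> d")
      case True
      then have "below S (n - d) \<le> below S (n - d')"
        using below_lipschitz[of "n-d" "n-d'" S] by simp
      then show ?thesis using m mm by linarith
    next
      case False
      then have "below S (n - d) \<le> below S (n - d') + ((n - d) - (n - d'))"
        using below_lipschitz[of "n-d'" "n-d" S] by simp
      then show ?thesis using m mm md by linarith
    qed
    then show ?thesis using le rs by (simp add: sc_diagram_def dd)
  qed
  then have "sc_diagram n S \<in> young n"
    unfolding in_young_iff by (auto simp: sc_diagram_def)
  moreover have "(sc_diagram n S)\<inverse> = sc_diagram n S"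
    by (auto simp: sc_diagram_def min.commute max.commute)
  ultimately show ?thesis by (simp add: sc_young_def)
qed

lemma sc_diagram_young: "sc_diagram n S \<in> young n"
  using sc_diagram_sc_young by (auto simp: sc_young_def)

lemma diag_count_sc_diagram:
  assumes "d \<le> n"
  shows "diag_count n (sc_diagram n S) d = below S d"
proof -
  have "t \<le> diag_count n (sc_diagram n S) d \<longleftrightarrow> t \<le> below S d" if t: "1 \<le> t" for t
  proof -
    have "t \<le> diag_count n (sc_diagram n S) d \<longleftrightarrow> (t + (n-d), t) \<in> sc_diagram n S"
      using diagonal_mem_iff[OF sc_diagram_young t, of n d S] assms by simp
    also have "\<dots> \<longleftrightarrow> t + (n-d) \<le> n \<and> t \<le> n \<and> t \<le> below S d"
    proof -
      have "min (t + (n-d)) t = t" "max (t + (n-d)) t = t + (n-d)" by auto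
      moreover have "t + (n-d) - t = n-d" by simp
      ultimately show ?thesis
        using t by (simp add: sc_diagram_def diff_diff_cancel[OF assms] del: add_diff_assoc diff_diff_right)
    qed
    also have "\<dots> \<longleftrightarrow> t \<le> d \<and> t \<le> below S d"
      using assms by linarith
    finally show ?thesis using below_le[of S d] by auto
  qed
  from this[of "diag_count n (sc_diagram n S) d"] this[of "below S d"] show ?thesis
    by (metis le_antisym le_zero_eq less_one not_le_imp_less order_refl)
qed

lemma mem_iff_below: "i \<in> S \<longleftrightarrow> below S (Suc i) = Suc (below S i)"
  by (simp add: below_Suc)

lemma sc_diagram_inj:
  assumes "S \<subseteq> {..<n}" "T \<subseteq> {..<n}" "sc_diagram n S = sc_diagram n T"
  shows "S = T"
proof -
  have "below S d = below T d" if "d \<le> n" for d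
    using diag_count_sc_diagram[OF that, of S] diag_count_sc_diagram[OF that, of T] assms(3) by simp
  then have "i \<in> S \<longleftrightarrow> i \<in> T" if "i < n" for i
    using that by (simp add: mem_iff_below)
  then show ?thesis using assms(1,2) by auto
qed

text \<open>Going from degree \<open>i\<close> to \<open>i + 1 \<le> n\<close>, the diagonal grows by at most one box, and the set of those
  \<open>i\<close> where it grows gives back the diagram.\<close>

lemma sc_diagram_surj:
  assumes Y: "Y \<in> sc_young n"
  obtains S where "S \<subseteq> {..<n}" "Y = sc_diagram n S"
proof -
  have Yy: "Y \<in> young n" using Y by (simp add: sc_young_def)
  define c where "c = diag_count n Y"
  have mem: "(t + (n-i), t) \<in> Y \<longleftrightarrow> t \<le> c i" if "1 \<le> t" "i \<le> n" for t i
    using diagonal_mem_iff[OF Yy that(1), of i] that(2) by (simp add: c_def)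
  have c0: "c 0 = 0"
  proof (rule ccontr)
    assume "c 0 \<noteq> 0"
    then have "(c 0 + n, c 0) \<in> Y" using mem[of "c 0" 0] by simp
    then show False using young_box[OF Yy] \<open>c 0 \<noteq> 0\<close> by fastforce
  qed
  have step1: "c i \<le> c (Suc i)" if "i < n" for i
  proof (cases "c i = 0")
    case False
    then have "(c i + (n-i), c i) \<in> Y" using mem[of "c i" i] that by simp
    then have "(c i + (n - Suc i), c i) \<in> Y"
      by (rule young_down[OF Yy]) (use False in auto)
    then show ?thesis using mem[of "c i" "Suc i"] False that by simp
  qed simp
  have step2: "c (Suc i) \<le> Suc (c i)" if "i < n" for i
  proof (cases "c (Suc i) \<le> 1")
    case False
    define t where "t = c (Suc i) - 1"
    have t: "1 \<le> t" "c (Suc i) = Suc t" using False by (auto simp: t_def)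
    have "(Suc t + (n - Suc i), Suc t) \<in> Y" using mem[of "Suc t" "Suc i"] that t by simp
    then have "(t + (n - i), t) \<in> Y"
      by (rule young_down[OF Yy]) (use t that in auto)
    then show ?thesis using mem[of t i] t that by simp
  qed simp
  define S where "S = {i. i < n \<and> c (Suc i) = Suc (c i)}"
  have below_S: "below S i = c i" if "i \<le> n" for i
    using that
  proof (induction i)
    case (Suc i)
    then show ?case using step1[of i] step2[of i] by (auto simp: below_Suc S_def)
  qed (simp add: c0)
  have "(r,s) \<in> Y \<longleftrightarrow> (r,s) \<in> sc_diagram n S" for r s
  proof (cases "1 \<le> r \<and> r \<le> n \<and> 1 \<le> s \<and> s \<le> n")
    case True
    then show ?thesis
      using sc_mem_iff[OF Y, of r s] below_S by (simp add: sc_diagram_def c_def)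
  next
    case False
    then show ?thesis using young_box[OF Yy, of r s] by (auto simp: sc_diagram_def)
  qed
  then have "Y = sc_diagram n S" by auto
  then show thesis using that[of S] by (auto simp: S_def)
qed

section \<open>Adding and removing vertices\<close>

text \<open>The relation that \<^const>\<open>f_tilde\<close> follows forwards and \<^const>\<open>e_tilde\<close> backwards.\<close>

definition covers :: "nat \<Rightarrow> nat \<Rightarrow> diagram \<Rightarrow> diagram \<Rightarrow> bool" where
  "covers n k Y Y' \<longleftrightarrow> (if k = n then adds_to n n Y Y' else adds2_to n k (2*n-k) Y Y')"

lemma covers_young: "covers n k Y Y' \<Longrightarrow> Y \<in> young n \<and> Y' \<in> young n"
  by (auto simp: covers_def adds_to_def adds2_to_def split: if_splits)

lemma diag_count_insert:
  assumes "finite Y" "b \<notin> Y"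
  shows "diag_count n (insert b Y) d = diag_count n Y d + (if box_degree n b = d then 1 else 0)"
proof (cases "box_degree n b = d")
  case True
  then have "{c \<in> insert b Y. box_degree n c = d} = insert b {c \<in> Y. box_degree n c = d}" by auto
  then show ?thesis using True assms by (simp add: diag_count_def)
next
  case False
  then have "{c \<in> insert b Y. box_degree n c = d} = {c \<in> Y. box_degree n c = d}" by auto
  then show ?thesis using False by (simp add: diag_count_def)
qed

lemma covers_diag_count:
  assumes "covers n k Y Y'" "k \<le> n"
  shows "diag_count n Y' d = diag_count n Y d + (if d = k \<or> d = 2*n-k then 1 else 0)"
proof -
  have fin: "finite Y" using covers_young[OF assms(1)] young_finite by blast
  show ?thesis
  proof (cases "k = n")
    case True
    then obtain b where "b \<notin> Y" "box_degree n b = n" "Y' = insert b Y"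
      using assms(1) by (auto simp: covers_def adds_to_def)
    then show ?thesis using True fin by (simp add: diag_count_insert)
  next
    case False
    then obtain b c where bc: "b \<notin> Y" "c \<notin> Y" "b \<noteq> c" "box_degree n b = k" "box_degree n c = 2*n-k"
      "Y' = insert b (insert c Y)"
      using assms(1) by (auto simp: covers_def adds2_to_def)
    moreover have "k \<noteq> 2*n-k" using False assms(2) by linarith
    ultimately show ?thesis using fin by (auto simp: diag_count_insert)
  qed
qed

text \<open>The vertices added or removed may a priori lead to any diagram; the diagonal counts show that
  the result is self-conjugate again.\<close>

lemma covers_sc_young:
  assumes "covers n k Y Y'" "k \<le> n"
  shows "Y \<in> sc_young n \<longleftrightarrow> Y' \<in> sc_young n"
proof -
  have "(2*n-d = k \<or> 2*n-d = 2*n-k) = (d = k \<or> d = 2*n-k)" if "d \<le> 2*n" for d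
    using that assms(2) by linarith
  then show ?thesis
    using covers_young[OF assms(1)] by (auto simp: sc_young_iff_diag_count covers_diag_count[OF assms])
qed

text \<open>Membership of \<open>i\<close> is the increment of \<^const>\<open>below\<close> at \<open>i\<close>, so raising a single value at \<open>k\<close>
  changes the increments at \<open>k - 1\<close> and at \<open>k\<close>. The latter is not visible if \<open>k = n\<close>.\<close>

lemma below_shift_iff:
  assumes k: "1 \<le> k" "k \<le> n" and S: "S \<subseteq> {..<n}" and T: "T \<subseteq> {..<n}"
  shows "(\<forall>d\<le>n. below T d = below S d + (if d = k then 1 else 0)) \<longleftrightarrow>
    k-1 \<notin> S \<and> (k < n \<longrightarrow> k \<in> S) \<and> T = insert (k-1) (S - {k})"
proof
  assume *: "\<forall>d\<le>n. below T d = below S d + (if d = k then 1 else 0)"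
  have bit: "(if i \<in> T then 1 else 0) + (if i = k then 1 else 0)
      = (if i \<in> S then 1 else 0) + (if i = k-1 then 1 else (0::nat))" if "i < n" for i
  proof -
    have iff: "(Suc i = k) = (i = k-1)" using k by auto
    have "below T i = below S i + (if i = k then 1 else 0)"
      "below T (Suc i) = below S (Suc i) + (if Suc i = k then 1 else 0)"
      using * that by auto
    then show ?thesis unfolding below_Suc iff by linarith
  qed
  have *: "k-1 \<notin> S" "k-1 \<in> T" 
  proof -
    have "k-1 < n" "k-1 \<noteq> k" using k by auto
    then show "k-1 \<notin> S" "k-1 \<in> T" using bit[of "k-1"] by (auto split: if_splits)
  qed
  have **: "k < n \<longrightarrow> k \<in> S \<and> k \<notin> T" 
  proof
    assume "k < n"
    moreover have "k \<noteq> k-1" using k by simp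
    ultimately show "k \<in> S \<and> k \<notin> T" using bit[of k] by (auto split: if_splits)
  qed
  have "i \<in> T \<longleftrightarrow> i = k-1 \<or> i \<in> S \<and> i \<noteq> k" for i
  proof (cases "i < n")
    case True
    show ?thesis
    proof (cases "i = k-1 \<or> i = k")
      case True
      then show ?thesis using * ** \<open>i < n\<close> k by (elim disjE) auto
    next
      case False
      then have ne: "i \<noteq> k-1" "i \<noteq> k" by blast+
      have "(if i \<in> T then 1 else 0) = (if i \<in> S then 1 else (0::nat))"
        using bit[OF \<open>i < n\<close>] unfolding if_not_P[OF ne(1)] if_not_P[OF ne(2)] by linarith
      then have "i \<in> T \<longleftrightarrow> i \<in> S" by (metis zero_neq_one)
      then show ?thesis using ne by blast
    qed
  next
    case False
    then have "i \<notin> T" "i \<notin> S" "i \<noteq> k-1" using S T k by auto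
    then show ?thesis by simp
  qed
  then show "k-1 \<notin> S \<and> (k < n \<longrightarrow> k \<in> S) \<and> T = insert (k-1) (S - {k})"
    using * ** by blast
next
  assume *: "k-1 \<notin> S \<and> (k < n \<longrightarrow> k \<in> S) \<and> T = insert (k-1) (S - {k})"
  have "below T d = below S d + (if d = k then 1 else 0)" if "d \<le> n" for d
    using that
  proof (induction d)
    case (Suc d)
    then have IH: "below T d = below S d + (if d = k then 1 else 0)" by simp
    consider "d = k" | "Suc d = k" | "d \<noteq> k" "Suc d \<noteq> k" by blast
    then show ?case
    proof cases
      case 1
      moreover have "k \<noteq> k-1" using k by simp
      ultimately have "d \<notin> T" "d \<in> S" using * Suc.prems by auto
      then show ?thesis using IH 1 by (simp add: below_Suc)
    next
      case 2
      then have "d = k-1" by simp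
      then have "d \<in> T" "d \<notin> S" using * by blast+
      then show ?thesis unfolding below_Suc using IH 2 by auto
    next
      case 3
      then have "d \<noteq> k-1" using k by simp
      then have "d \<in> T \<longleftrightarrow> d \<in> S" using * 3 by blast
      then show ?thesis using IH 3 by (simp add: below_Suc)
    qed
  qed (use k in simp)
  then show "\<forall>d\<le>n. below T d = below S d + (if d = k then 1 else 0)" by blast
qed

text \<open>Adding a vertex of degree \<open>k\<close>, with its mirror image if \<open>k < n\<close>, lengthens exactly one of the
  diagonals of degree at most \<open>n\<close>. The new box fits into the square because \<open>k - 1\<close> was missing.\<close>

lemma covers_sc_diagram_iff:
  assumes k: "1 \<le> k" "k \<le> n" and S: "S \<subseteq> {..<n}" and T: "T \<subseteq> {..<n}"
  shows "covers n k (sc_diagram n S) (sc_diagram n T) \<longleftrightarrow>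
    k-1 \<notin> S \<and> (k < n \<longrightarrow> k \<in> S) \<and> T = insert (k-1) (S - {k})"
  unfolding below_shift_iff[OF assms, symmetric]
proof
  assume c: "covers n k (sc_diagram n S) (sc_diagram n T)"
  show "\<forall>d\<le>n. below T d = below S d + (if d = k then 1 else 0)"
  proof (intro allI impI)
    fix d assume "d \<le> n"
    moreover from this have "(d = k \<or> d = 2*n-k) = (d = k)" using k by linarith
    ultimately show "below T d = below S d + (if d = k then 1 else 0)"
      using covers_diag_count[OF c k(2), of d] by (simp add: diag_count_sc_diagram)
  qed
next
  assume *: "\<forall>d\<le>n. below T d = below S d + (if d = k then 1 else 0)"
  define m where "m = below S k + 1"
  have mT: "below T k = m" using * k by (simp add: m_def)
  have mk: "m + (n-k) \<le> n" using below_le[of T k] mT k by linarith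
  have mem: "(r,s) \<in> sc_diagram n T \<longleftrightarrow>
      (r,s) \<in> sc_diagram n S \<or> (r,s) = (m + (n-k), m) \<or> (r,s) = (m, m + (n-k))" for r s
  proof (cases "r \<in> {1..n} \<and> s \<in> {1..n}")
    case True
    define \<delta> where "\<delta> = max r s - min r s"
    have \<delta>: "\<delta> < n" "max r s = min r s + \<delta>" using True by (auto simp: \<delta>_def)
    have "min r s \<le> below T (n - \<delta>) \<longleftrightarrow> min r s \<le> below S (n - \<delta>) \<or> n - \<delta> = k \<and> min r s = m"
      using *[rule_format, of "n - \<delta>"] by (auto simp: m_def)
    moreover have "n - \<delta> = k \<longleftrightarrow> \<delta> = n-k" using \<delta> k by linarith
    moreover have "\<delta> = n-k \<and> min r s = m \<longleftrightarrow> (r,s) = (m + (n-k), m) \<or> (r,s) = (m, m + (n-k))"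
      using \<delta>(2) by (auto simp: min_def max_def split: if_splits)
    ultimately show ?thesis using True by (simp add: sc_diagram_def \<delta>_def)
  next
    case False
    then show ?thesis using mk by (auto simp: sc_diagram_def m_def)
  qed
  have new: "(m + (n-k), m) \<notin> sc_diagram n S" "(m, m + (n-k)) \<notin> sc_diagram n S"
    using diagonal_mem_iff[OF sc_diagram_young, of m n k S] diag_count_sc_diagram[OF k(2), of S]
      sc_diagram_sc_young[of n S] k by (auto simp: m_def sc_young_def)
  have deg: "box_degree n (m + (n-k), m) = k" "box_degree n (m, m + (n-k)) = 2*n-k"
    using k by (auto simp: box_degree_def)
  show "covers n k (sc_diagram n S) (sc_diagram n T)"
  proof (cases "k = n")
    case True
    then have "sc_diagram n T = insert (m,m) (sc_diagram n S)" using mem by auto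
    then show ?thesis
      using True new deg sc_diagram_young[of n S] sc_diagram_young[of n T]
      by (auto simp: covers_def adds_to_def)
  next
    case False
    then have "sc_diagram n T = sc_diagram n S \<union> {(m + (n-k), m), (m, m + (n-k))}" using mem by auto
    moreover have "(m + (n-k), m) \<noteq> (m, m + (n-k))" using False k by simp
    ultimately show ?thesis
      using False new deg unfolding covers_def adds2_to_def if_not_P[OF False]
      by (intro conjI sc_diagram_young exI[of _ "(m + (n-k), m)"] exI[of _ "(m, m + (n-k))"])
  qed
qed

text \<open>The index \<open>n\<close> leaves the subset as it is. It occurs for the last simple root, which moves a single
  vertex, and for the middle Clifford generator, which acts diagonally.\<close>

definition toggle :: "nat \<Rightarrow> nat \<Rightarrow> nat set \<Rightarrow> nat set" where
  "toggle n i S = (if i < n then (S - {i}) \<union> ({i} - S) else S)"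

lemma toggle_subset: "S \<subseteq> {..<n} \<Longrightarrow> toggle n i S \<subseteq> {..<n}"
  by (auto simp: toggle_def)

lemma toggle_toggle [simp]: "toggle n i (toggle n i S) = S"
  by (auto simp: toggle_def)

lemma toggle_commute: "toggle n i (toggle n j S) = toggle n j (toggle n i S)"
  by (auto simp: toggle_def)

lemma mem_toggle: "i < n \<Longrightarrow> i \<in> toggle n j S \<longleftrightarrow> (if i = j then i \<notin> S else i \<in> S)"
  by (auto simp: toggle_def)

lemma the_or_ghost_eq:
  assumes "\<And>Y. P Y \<longleftrightarrow> C \<and> Y = Z"
  shows "the_or_ghost P = (if C then Some Z else None)"
proof -
  have "P = (\<lambda>Y. C \<and> Y = Z)" using assms by blast
  then show ?thesis by (simp add: the_or_ghost_def)
qed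

lemma f_tilde_sc_diagram:
  assumes k: "1 \<le> k" "k \<le> n" and S: "S \<subseteq> {..<n}"
  shows "f_tilde n k (sc_diagram n S) = (if k-1 \<notin> S \<and> (k < n \<longrightarrow> k \<in> S)
    then Some (sc_diagram n (toggle n (k-1) (toggle n k S))) else None)"
proof -
  have eq: "toggle n (k-1) (toggle n k S) = insert (k-1) (S - {k})"
    if "k-1 \<notin> S \<and> (k < n \<longrightarrow> k \<in> S)"
    using that k S by (auto simp: toggle_def)
  have "f_tilde n k (sc_diagram n S) = the_or_ghost (\<lambda>Y. covers n k (sc_diagram n S) Y)"
    by (simp add: f_tilde_def add_vertex_def add_vertices_def covers_def)
  also have "\<dots> = (if k-1 \<notin> S \<and> (k < n \<longrightarrow> k \<in> S)
    then Some (sc_diagram n (toggle n (k-1) (toggle n k S))) else None)"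
  proof (rule the_or_ghost_eq)
    fix Y
    show "covers n k (sc_diagram n S) Y \<longleftrightarrow>
      (k-1 \<notin> S \<and> (k < n \<longrightarrow> k \<in> S)) \<and> Y = sc_diagram n (toggle n (k-1) (toggle n k S))"
    proof
      assume c: "covers n k (sc_diagram n S) Y"
      then have "Y \<in> sc_young n" using covers_sc_young k sc_diagram_sc_young by blast
      then obtain T where T: "T \<subseteq> {..<n}" "Y = sc_diagram n T" by (rule sc_diagram_surj)
      then show "(k-1 \<notin> S \<and> (k < n \<longrightarrow> k \<in> S)) \<and> Y = sc_diagram n (toggle n (k-1) (toggle n k S))"
        using c covers_sc_diagram_iff[OF k S T(1)] eq by auto
    next
      assume "(k-1 \<notin> S \<and> (k < n \<longrightarrow> k \<in> S)) \<and> Y = sc_diagram n (toggle n (k-1) (toggle n k S))"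
      then have cond: "k-1 \<notin> S \<and> (k < n \<longrightarrow> k \<in> S)"
        and Y: "Y = sc_diagram n (toggle n (k-1) (toggle n k S))" by blast+
      show "covers n k (sc_diagram n S) Y"
        unfolding Y covers_sc_diagram_iff[OF k S toggle_subset[OF toggle_subset[OF S]]]
        using cond eq[OF cond] by blast
    qed
  qed
  finally show ?thesis .
qed

lemma e_tilde_sc_diagram:
  assumes k: "1 \<le> k" "k \<le> n" and S: "S \<subseteq> {..<n}"
  shows "e_tilde n k (sc_diagram n S) = (if k-1 \<in> S \<and> k \<notin> S
    then Some (sc_diagram n (toggle n (k-1) (toggle n k S))) else None)"
proof -
  have "e_tilde n k (sc_diagram n S) = the_or_ghost (\<lambda>Y. covers n k Y (sc_diagram n S))"
    by (simp add: e_tilde_def remove_vertex_def remove_vertices_def covers_def)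
  also have "\<dots> = (if k-1 \<in> S \<and> k \<notin> S
    then Some (sc_diagram n (toggle n (k-1) (toggle n k S))) else None)"
  proof (rule the_or_ghost_eq)
    fix Y
    show "covers n k Y (sc_diagram n S) \<longleftrightarrow>
      (k-1 \<in> S \<and> k \<notin> S) \<and> Y = sc_diagram n (toggle n (k-1) (toggle n k S))"
    proof
      assume c: "covers n k Y (sc_diagram n S)"
      then have "Y \<in> sc_young n" using covers_sc_young k sc_diagram_sc_young by blast
      then obtain T where T: "T \<subseteq> {..<n}" "Y = sc_diagram n T" by (rule sc_diagram_surj)
      then have c': "k-1 \<notin> T" "k < n \<longrightarrow> k \<in> T" "S = insert (k-1) (T - {k})"
        using c covers_sc_diagram_iff[OF k T(1) S] by auto
      then have "T = toggle n (k-1) (toggle n k S)"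
        using k T(1) by (auto simp: toggle_def)
      then show "(k-1 \<in> S \<and> k \<notin> S) \<and> Y = sc_diagram n (toggle n (k-1) (toggle n k S))"
        using T(2) c' k by auto
    next
      assume *: "(k-1 \<in> S \<and> k \<notin> S) \<and> Y = sc_diagram n (toggle n (k-1) (toggle n k S))"
      define T where "T = toggle n (k-1) (toggle n k S)"
      have T: "T \<subseteq> {..<n}" unfolding T_def by (intro toggle_subset S)
      have Y: "Y = sc_diagram n T" using * by (simp add: T_def)
      have "k-1 \<notin> T \<and> (k < n \<longrightarrow> k \<in> T) \<and> S = insert (k-1) (T - {k})"
        using * k by (auto simp: toggle_def T_def)
      then show "covers n k Y (sc_diagram n S)"
        unfolding Y covers_sc_diagram_iff[OF k T S] .
    qed
  qed
  finally show ?thesis .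
qed

text \<open>Summation by parts: the number of vertices of degree \<open>k\<close> is a partial sum over \<open>S\<close>, so each \<open>i\<close> in \<open>S\<close>
  subtracts \<open>\<alpha>\<^bsub>i+1\<^esub> + \<dots> + \<alpha>\<^sub>n = \<epsilon>\<^bsub>i+1\<^esub>\<close> from the highest weight.\<close>

lemma wt_sc_diagram:
  assumes S: "S \<subseteq> {..<n}"
  shows "wt n (sc_diagram n S) H = (\<Sum>i<n. (if i \<in> S then - 1/2 else 1/2) * H $$ (i,i))"
proof -
  have fw: "fund_weight n n H = (\<Sum>i<n. H $$ (i,i)) / 2"
  proof -
    have "(\<Sum>j=1..n. eps j H) = (\<Sum>i<n. H $$ (i,i))"
      by (rule sum.reindex_bij_witness[of _ Suc "\<lambda>j. j-1"]) (auto simp: eps_def)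
    then show ?thesis by (simp add: fund_weight_def)
  qed
  have partial: "(\<Sum>i=1..m. of_nat (below S i) * (H $$ (i-1,i-1) - H $$ (i,i)))
      = (\<Sum>i<m. if i \<in> S then H $$ (i,i) else 0) - of_nat (below S m) * H $$ (m,m)" for m
    by (induction m) (auto simp: below_Suc algebra_simps)
  have "(\<Sum>i=1..n. of_nat (below S i) * simple_root n i H) = (\<Sum>i<n. if i \<in> S then H $$ (i,i) else 0)"
  proof (cases n)
    case (Suc m)
    have "(\<Sum>i=1..n. of_nat (below S i) * simple_root n i H)
        = (\<Sum>i=1..m. of_nat (below S i) * simple_root n i H) + of_nat (below S n) * H $$ (m,m)"
      using Suc by (simp add: simple_root_def eps_def)
    also have "(\<Sum>i=1..m. of_nat (below S i) * simple_root n i H)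
        = (\<Sum>i=1..m. of_nat (below S i) * (H $$ (i-1,i-1) - H $$ (i,i)))"
      by (rule sum.cong) (use Suc in \<open>auto simp: simple_root_def eps_def\<close>)
    finally show ?thesis using partial[of m] Suc by (simp add: below_Suc algebra_simps)
  qed simp
  moreover have "(\<Sum>i=1..n. of_nat (card {b \<in> sc_diagram n S. box_degree n b = i}) * simple_root n i H)
      = (\<Sum>i=1..n. of_nat (below S i) * simple_root n i H)"
    by (rule sum.cong) (use diag_count_sc_diagram[of _ n S] in \<open>auto simp: diag_count_def\<close>)
  ultimately have "wt n (sc_diagram n S) H
      = (\<Sum>i<n. H $$ (i,i)) / 2 - (\<Sum>i<n. if i \<in> S then H $$ (i,i) else 0)"
    by (simp add: wt_def fw)
  also have "\<dots> = (\<Sum>i<n. (if i \<in> S then - 1/2 else 1/2) * H $$ (i,i))"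
    unfolding sum_divide_distrib sum_subtractf[symmetric] by (rule sum.cong) auto
  finally show ?thesis .
qed

section \<open>The spin representation on self-conjugate diagrams\<close>

interpretation fs: vector_space fscale
  by (rule vector_space_fscale)

lemma lin_ext_superset:
  assumes "finite K" "Poly_Mapping.keys v \<subseteq> K"
  shows "lin_ext h v = (\<Sum>a\<in>K. fscale (Poly_Mapping.lookup v a) (h a))"
  unfolding lin_ext_def
  by (rule sum.mono_neutral_left) (use assms in \<open>auto simp: in_keys_iff\<close>)

lemma lin_ext_add: "lin_ext h (v + w) = lin_ext h v + lin_ext h w"
proof -
  let ?K = "Poly_Mapping.keys v \<union> Poly_Mapping.keys w"
  have "lin_ext h (v + w) = (\<Sum>a\<in>?K. fscale (Poly_Mapping.lookup (v + w) a) (h a))"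
    by (rule lin_ext_superset) (use Poly_Mapping.keys_add[of v w] in auto)
  also have "\<dots> = lin_ext h v + lin_ext h w"
    using lin_ext_superset[of ?K v h] lin_ext_superset[of ?K w h]
    by (simp add: Poly_Mapping.lookup_add fs.scale_left_distrib sum.distrib)
  finally show ?thesis .
qed

lemma lin_ext_scale: "lin_ext h (fscale c v) = fscale c (lin_ext h v)"
proof -
  have "lin_ext h (fscale c v)
      = (\<Sum>a\<in>Poly_Mapping.keys v. fscale (Poly_Mapping.lookup (fscale c v) a) (h a))"
    by (rule lin_ext_superset) (auto simp: in_keys_iff)
  then show ?thesis by (simp add: lin_ext_def fs.scale_sum_right)
qed

lemma lin_ext_basis_vec [simp]: "lin_ext h (basis_vec a) = h a"
  by (simp add: lin_ext_def basis_vec_def)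

definition bvec :: "nat \<Rightarrow> nat set \<Rightarrow> (diagram \<Rightarrow>\<^sub>0 complex)" where
  "bvec n S = basis_vec (sc_diagram n S)"

lemma sc_space_eq: "sc_space n = fs.span (bvec n ` Pow {..<n})"
proof -
  have "sc_young n = sc_diagram n ` Pow {..<n}"
    using sc_diagram_sc_young by (auto elim: sc_diagram_surj)
  then show ?thesis by (simp add: sc_space_def bvec_def image_image)
qed

lemma subspace_sc_space: "fs.subspace (sc_space n)"
  by (simp add: sc_space_eq)

lemma bvec_in [simp]: "S \<subseteq> {..<n} \<Longrightarrow> bvec n S \<in> sc_space n"
  unfolding sc_space_eq by (rule fs.span_base) auto

lemma bvec_nonzero: "bvec n S \<noteq> 0"
  unfolding bvec_def basis_vec_def by (metis lookup_single_eq lookup_zero zero_neq_one)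

lemma sc_space_induct [consumes 1, case_names basis add scale]:
  assumes v: "v \<in> sc_space n"
    and basis: "\<And>S. S \<subseteq> {..<n} \<Longrightarrow> P (bvec n S)"
    and add: "\<And>x y. x \<in> sc_space n \<Longrightarrow> y \<in> sc_space n \<Longrightarrow> P x \<Longrightarrow> P y \<Longrightarrow> P (x + y)"
    and scale: "\<And>c x. x \<in> sc_space n \<Longrightarrow> P x \<Longrightarrow> P (fscale c x)"
  shows "P v"
proof -
  have "v \<in> sc_space n \<and> P v"
    using v unfolding sc_space_eq
  proof (induction rule: fs.span_induct_alt)
    case base
    have "P (fscale 0 (bvec n {}))" by (intro scale basis bvec_in) auto
    then show ?case by (simp add: fs.span_zero)
  next
    case (step c x y)
    then obtain S where S: "S \<subseteq> {..<n}" "x = bvec n S" by auto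
    then show ?case using step
      by (auto simp: sc_space_eq[symmetric] intro!: add scale basis
          fs.subspace_add fs.subspace_scale subspace_sc_space)
  qed
  then show ?thesis ..
qed

text \<open>The Clifford generator of index \<open>j < n\<close> removes \<open>j\<close> from a subset, that of index \<open>j' > n\<close> inserts
  \<open>j\<close>, and the middle one is diagonal. The Jordan-Wigner sign, which makes them anticommute, counts the
  missing elements below the position concerned. The relations would also hold if the
  present ones were counted, but with the missing ones all signs cancel in the Chevalley generators.\<close>

definition jw_sign :: "nat \<Rightarrow> nat set \<Rightarrow> complex" where
  "jw_sign i S = (-1) ^ card ({..<i} - S)"

definition spin_factor :: "nat \<Rightarrow> nat \<Rightarrow> nat set \<Rightarrow> complex" where
  "spin_factor n j S = (if j < n then if j \<in> S then 2 else 0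
     else if j = n then 1 else if 2*n-j \<in> S then 0 else 1)"

definition subset_of :: "nat \<Rightarrow> diagram \<Rightarrow> nat set" where
  "subset_of n = inv_into (Pow {..<n}) (sc_diagram n)"

definition gamma_op :: "nat \<Rightarrow> nat \<Rightarrow> (diagram \<Rightarrow>\<^sub>0 complex) \<Rightarrow> (diagram \<Rightarrow>\<^sub>0 complex)" where
  "gamma_op n j = lin_ext (\<lambda>Y. let S = subset_of n Y; m = min j (2*n-j) in
     fscale (spin_factor n j S * jw_sign m S) (bvec n (toggle n m S)))"

lemma gamma_op_bvec:
  assumes "S \<subseteq> {..<n}"
  shows "gamma_op n j (bvec n S) = fscale (spin_factor n j S * jw_sign (min j (2*n-j)) S)
    (bvec n (toggle n (min j (2*n-j)) S))"
proof -
  have "subset_of n (sc_diagram n S) = S"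
    unfolding subset_of_def using assms sc_diagram_inj
    by (intro inv_into_f_f) (auto simp: inj_on_def)
  then show ?thesis
    unfolding gamma_op_def bvec_def[of n S] by (simp add: Let_def)
qed

lemma gamma_op_add: "gamma_op n j (v + w) = gamma_op n j v + gamma_op n j w"
  and gamma_op_scale: "gamma_op n j (fscale c v) = fscale c (gamma_op n j v)"
  by (simp_all add: gamma_op_def lin_ext_add lin_ext_scale)

lemma jw_sign_square: "jw_sign i S * jw_sign i S = 1"
  by (simp add: jw_sign_def flip: power_add)

lemma jw_sign_toggle_ge: "i \<le> j \<Longrightarrow> jw_sign i (toggle n j S) = jw_sign i S"
  unfolding jw_sign_def toggle_def
  by (intro arg_cong[where f="\<lambda>A. (-1) ^ card A"]) auto

lemma jw_sign_toggle_less: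
  assumes "j < i" "j < n"
  shows "jw_sign i (toggle n j S) = - jw_sign i S"
proof (cases "j \<in> S")
  case True
  then have "{..<i} - toggle n j S = insert j ({..<i} - S)"
    using assms by (auto simp: toggle_def)
  then show ?thesis using True by (simp add: jw_sign_def)
next
  case False
  then have "{..<i} - S = insert j ({..<i} - toggle n j S)" "j \<notin> {..<i} - toggle n j S"
    using assms by (auto simp: toggle_def)
  then show ?thesis by (simp add: jw_sign_def)
qed

lemma jw_sign_Suc: "i \<in> S \<Longrightarrow> jw_sign (Suc i) S = jw_sign i S"
  unfolding jw_sign_def by (intro arg_cong[where f="\<lambda>A. (-1) ^ card A"]) (auto simp: less_Suc_eq)

lemma spin_factor_toggle:
  assumes "min j (2*n-j) \<noteq> m"
  shows "spin_factor n j (toggle n m S) = spin_factor n j S"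
  using assms by (auto simp: spin_factor_def toggle_def min_def split: if_splits)

text \<open>The relation at a single position, without signs. The two generators \<open>\<gamma>\<^sub>j\<close> and \<open>\<gamma>\<^sub>j\<^sub>'\<close> there
  are twice an annihilation operator and a creation operator, or both are the middle one.\<close>

lemma spin_factor_pair:
  assumes "i \<le> 2*n" "j \<le> 2*n" and m: "min i (2*n-i) = min j (2*n-j)"
  shows "spin_factor n j S * spin_factor n i (toggle n (min j (2*n-j)) S)
    + spin_factor n i S * spin_factor n j (toggle n (min j (2*n-j)) S) = (if i + j = 2*n then 2 else 0)"
proof -
  have *: "i = j \<or> i = 2*n-j" using assms by (auto simp: min_def split: if_splits)
  consider "j = n" | "j < n" | "j > n" by linarith
  then show ?thesis
  proof cases
    case 1
    then have "i = n" using * by auto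
    then show ?thesis using 1 by (simp add: spin_factor_def)
  next
    case 2
    then have t: "min j (2*n-j) = j" "j \<in> toggle n j S \<longleftrightarrow> j \<notin> S" by (auto simp: toggle_def)
    have "\<not> 2*n-j < n" "2*n-j \<noteq> n" using 2 by linarith+
    then have d: "spin_factor n (2*n-j) A = (if j \<in> A then 0 else 1)" for A
      using 2 by (simp add: spin_factor_def)
    have c: "spin_factor n j A = (if j \<in> A then 2 else 0)" for A
      using 2 by (simp add: spin_factor_def)
    show ?thesis
      using *
    proof
      assume "i = j"
      moreover have "j + j \<noteq> 2*n" using 2 by simp
      ultimately show ?thesis by (simp add: c t)
    next
      assume i: "i = 2*n-j"
      then have "i + j = 2*n" using 2 by simp
      then show ?thesis unfolding i by (simp add: c d t)
    qed
  next
    case 3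
    define l where "l = 2*n-j"
    have l: "l < n" "j = 2*n-l" "2*n-j = l" using 3 assms by (auto simp: l_def)
    then have t: "min j (2*n-j) = l" "l \<in> toggle n l S \<longleftrightarrow> l \<notin> S" by (auto simp: toggle_def)
    have d: "spin_factor n j A = (if l \<in> A then 0 else 1)" for A
      using 3 l by (simp add: spin_factor_def)
    have c: "spin_factor n l A = (if l \<in> A then 2 else 0)" for A
      using l by (simp add: spin_factor_def)
    show ?thesis
      using *[unfolded l(3)]
    proof
      assume "i = j"
      moreover have "j + j \<noteq> 2*n" using 3 by simp
      ultimately show ?thesis by (simp add: d t)
    next
      assume i: "i = l"
      then have "i + j = 2*n" using l 3 assms by simp
      then show ?thesis unfolding i by (simp add: c d t)
    qed
  qed
qed

lemma gamma_gamma_bvec: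
  assumes S: "S \<subseteq> {..<n}" and m: "mi = min i (2*n-i)" "mj = min j (2*n-j)"
  shows "gamma_op n i (gamma_op n j (bvec n S)) =
    fscale (spin_factor n j S * spin_factor n i (toggle n mj S) * (jw_sign mj S * jw_sign mi (toggle n mj S)))
      (bvec n (toggle n mi (toggle n mj S)))"
  using gamma_op_bvec[OF S, of j] gamma_op_bvec[OF toggle_subset[OF S], of i mj] m
  by (simp add: gamma_op_scale mult_ac)

text \<open>At different positions one of the two signs is sensitive to the other toggle and the second is not,
  so exchanging the generators changes the sign. At the same position the signs square to one.\<close>

lemma gamma_anticommute:
  assumes ij: "i \<le> 2*n" "j \<le> 2*n" and v: "v \<in> sc_space n"
  shows "gamma_op n i (gamma_op n j v) + gamma_op n j (gamma_op n i v) = fscale (if i + j = 2*n then 2 else 0) v"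
  using v
proof (induction rule: sc_space_induct)
  case (basis S)
  define mi mj where m: "mi = min i (2*n-i)" "mj = min j (2*n-j)"
  note gg = gamma_gamma_bvec[OF basis m] gamma_gamma_bvec[OF basis m(2,1)]
  show ?case
  proof (cases "mi = mj")
    case True
    have "gamma_op n i (gamma_op n j (bvec n S)) + gamma_op n j (gamma_op n i (bvec n S))
       = fscale (spin_factor n j S * spin_factor n i (toggle n mj S)
           + spin_factor n i S * spin_factor n j (toggle n mj S)) (bvec n S)"
      unfolding gg by (simp add: True jw_sign_toggle_ge jw_sign_square fs.scale_left_distrib)
    then show ?thesis using spin_factor_pair[OF ij, of S] True m by simp
  next
    case False
    have ne: "i + j \<noteq> 2*n" using False m ij by (auto simp: min_def split: if_splits)
    have le: "mi \<le> n" "mj \<le> n" using ij m by auto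
    have sp: "spin_factor n i (toggle n mj S) = spin_factor n i S"
      "spin_factor n j (toggle n mi S) = spin_factor n j S"
      using False m by (auto intro!: spin_factor_toggle)
    have "jw_sign mj S * jw_sign mi (toggle n mj S) = - (jw_sign mi S * jw_sign mj (toggle n mi S))"
    proof (cases "mi < mj")
      case True
      then show ?thesis
        using jw_sign_toggle_less[of mi mj n S] jw_sign_toggle_ge[of mi mj n S] le by simp
    next
      case f: False
      then show ?thesis
        using jw_sign_toggle_less[of mj mi n S] jw_sign_toggle_ge[of mj mi n S] le False by simp
    qed
    then show ?thesis
      unfolding gg sp toggle_commute[of n mj mi S] using ne
      by (simp add: mult.commute[of "spin_factor n j S"])
  qed
qed (simp_all add: gamma_op_add gamma_op_scale fs.scale_right_distrib algebra_simps flip: fs.scale_right_distrib)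

interpretation spin: clifford_action fscale n "sc_space n" "gamma_op n" for n
proof
  fix i v assume v: "v \<in> sc_space n"
  show "gamma_op n i v \<in> sc_space n"
    using v
  proof (induction rule: sc_space_induct)
    case (basis S)
    then show ?case
      by (simp add: gamma_op_bvec toggle_subset fs.subspace_scale[OF subspace_sc_space])
  qed (simp_all add: gamma_op_add gamma_op_scale fs.subspace_add[OF subspace_sc_space]
      fs.subspace_scale[OF subspace_sc_space])
qed (simp_all add: subspace_sc_space gamma_op_add gamma_op_scale gamma_anticommute)

definition spin_rep :: "nat \<Rightarrow> complex mat \<Rightarrow> (diagram \<Rightarrow>\<^sub>0 complex) \<Rightarrow> (diagram \<Rightarrow>\<^sub>0 complex)" where
  "spin_rep n = spin.act n"

lemma so_rep_spin_rep: "so_rep n fscale (sc_space n) (spin_rep n)"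
  unfolding spin_rep_def by (rule spin.so_rep_act)

interpretation spin_rep: so_module n fscale "sc_space n" "spin_rep n" for n
  by unfold_locales (rule so_rep_spin_rep)

lemma spin_rep_root_mat_bvec:
  assumes S: "S \<subseteq> {..<n}" and ij: "i \<le> 2*n" "j \<le> 2*n" "i \<noteq> j"
    and m: "mi = min i (2*n-i)" "mj = min j (2*n-j)"
  shows "spin_rep n (root_mat n i j) (bvec n S) =
    fscale (1/2 * (spin_factor n (2*n-j) S * spin_factor n i (toggle n mj S)
      * (jw_sign mj S * jw_sign mi (toggle n mj S)))) (bvec n (toggle n mi (toggle n mj S)))"
proof -
  have "mj = min (2*n-j) (2*n-(2*n-j))" using m(2) ij(2) by simp
  then show ?thesis
    using S ij gamma_gamma_bvec[OF S m(1), of mj "2*n-j"]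
    by (simp add: spin_rep_def spin.act_root_mat)
qed

text \<open>The sign at \<open>k\<close> equals that at \<open>k - 1\<close> because \<open>k - 1\<close> is not missing, so the two cancel. The
  Clifford factor for \<open>k = n\<close> fits the same formula, as \<open>n\<close> is never an element.\<close>

lemma spin_rep_chev_e_bvec:
  assumes k: "k \<in> {1..n}" and S: "S \<subseteq> {..<n}"
  shows "spin_rep n (chev_e n k) (bvec n S) =
    (if k-1 \<in> S \<and> k \<notin> S then bvec n (toggle n (k-1) (toggle n k S)) else 0)"
proof -
  have m: "k-1 = min (k-1) (2*n-(k-1))" "k = min k (2*n-k)" using k by auto
  have f1: "spin_factor n (2*n-k) S = (if k \<in> S then 0 else 1)"
  proof (cases "k = n")
    case True
    then show ?thesis using S by (auto simp: spin_factor_def)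
  next
    case False
    then have "\<not> 2*n-k < n" "2*n-k \<noteq> n" "2*n-(2*n-k) = k" using k by auto
    then show ?thesis by (simp add: spin_factor_def)
  qed
  have "k-1 < n" "k-1 \<noteq> k" using k by auto
  then have f2: "spin_factor n (k-1) (toggle n k S) = (if k-1 \<in> S then 2 else 0)"
    by (simp add: spin_factor_def mem_toggle)
  have sg: "jw_sign k S * jw_sign (k-1) (toggle n k S) = 1" if "k-1 \<in> S"
    using jw_sign_Suc[OF that] k by (simp add: jw_sign_toggle_ge jw_sign_square)
  have le: "k-1 \<le> 2*n" "k \<le> 2*n" using k by auto
  show ?thesis
    unfolding chev_e_eq[OF k] spin_rep_root_mat_bvec[OF S le \<open>k-1 \<noteq> k\<close> m] f1 f2
    using sg by auto
qed

text \<open>Again the signs cancel, because \<open>k - 1\<close> has been inserted when the second one is taken. The factor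
  2 in \<open>f\<^sub>n\<close> makes up for the middle generator lacking the factor 2 of an annihilation operator.\<close>

lemma spin_rep_chev_f_bvec:
  assumes k: "k \<in> {1..n}" and S: "S \<subseteq> {..<n}"
  shows "spin_rep n (chev_f n k) (bvec n S) =
    (if k-1 \<notin> S \<and> (k < n \<longrightarrow> k \<in> S) then bvec n (toggle n (k-1) (toggle n k S)) else 0)"
proof -
  have m: "k = min k (2*n-k)" "k-1 = min (k-1) (2*n-(k-1))" using k by auto
  have "\<not> 2*n-(k-1) < n" "2*n-(k-1) \<noteq> n" "2*n-(2*n-(k-1)) = k-1" using k by auto
  then have f1: "spin_factor n (2*n-(k-1)) S = (if k-1 \<in> S then 0 else 1)"
    by (simp add: spin_factor_def)
  have ne: "k-1 < n" "k-1 \<noteq> k" "k \<noteq> k-1" "k \<le> 2*n" "k-1 \<le> 2*n" using k by auto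
  have f2: "(if k = n then 2 else 1) * spin_factor n k (toggle n (k-1) S) = (if k < n \<longrightarrow> k \<in> S then 2 else 0)"
  proof (cases "k < n")
    case True
    then show ?thesis using ne by (simp add: spin_factor_def mem_toggle)
  next
    case False
    then show ?thesis using k by (simp add: spin_factor_def)
  qed
  have sg: "jw_sign (k-1) S * jw_sign k (toggle n (k-1) S) = 1" if "k-1 \<notin> S"
  proof -
    have "k-1 \<in> toggle n (k-1) S" using that ne by (simp add: mem_toggle)
    then show ?thesis
      using jw_sign_Suc[of "k-1" "toggle n (k-1) S"] k by (simp add: jw_sign_toggle_ge jw_sign_square)
  qed
  have "spin_rep n (chev_f n k) (bvec n S)
      = fscale (if k = n then 2 else 1) (spin_rep n (root_mat n k (k-1)) (bvec n S))"
    unfolding chev_f_eq[OF k] by (intro spin_rep.smult_act root_mat_in_so_odd ne bvec_in S)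
  also have "\<dots> = fscale (1/2 * spin_factor n (2*n-(k-1)) S
        * ((if k = n then 2 else 1) * spin_factor n k (toggle n (k-1) S))
        * (jw_sign (k-1) S * jw_sign k (toggle n (k-1) S))) (bvec n (toggle n k (toggle n (k-1) S)))"
    unfolding spin_rep_root_mat_bvec[OF S ne(4,5,3) m] by (simp add: mult_ac)
  also have "\<dots> = (if k-1 \<notin> S \<and> (k < n \<longrightarrow> k \<in> S) then bvec n (toggle n (k-1) (toggle n k S)) else 0)"
    unfolding f1 f2 toggle_commute[of n k "k-1" S] using sg by auto
  finally show ?thesis .
qed

text \<open>Each commutator of an annihilation and a creation operator is diagonal and tells whether the element
  is present; this is the weight in the form of \<open>wt_sc_diagram\<close>.\<close>

lemma spin_rep_cartan_bvec:
  assumes H: "H \<in> cartan n" and S: "S \<subseteq> {..<n}"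
  shows "spin_rep n H (bvec n S) = fscale (wt n (sc_diagram n S) H) (bvec n S)"
proof -
  have number: "gamma_op n i (gamma_op n (2*n-i) (bvec n S)) - gamma_op n (2*n-i) (gamma_op n i (bvec n S))
      = fscale (if i \<in> S then -2 else 2) (bvec n S)" if i: "i < n" for i
  proof -
    have m: "i = min i (2*n-i)" "i = min (2*n-i) (2*n-(2*n-i))" using i by auto
    have b: "\<not> 2*n-i < n" "2*n-i \<noteq> n" "2*n-(2*n-i) = i" using i by auto
    show ?thesis
      unfolding gamma_gamma_bvec[OF S m] gamma_gamma_bvec[OF S m(2,1)]
      using i b by (simp add: spin_factor_def mem_toggle jw_sign_toggle_ge jw_sign_square
          flip: fs.scale_left_diff_distrib)
  qed
  have "spin_rep n H (bvec n S)
      = fscale (1/4) (\<Sum>i<n. fscale (H $$ (i,i)) (fscale (if i \<in> S then -2 else 2) (bvec n S)))"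
    unfolding spin_rep_def spin.act_cartan[OF H bvec_in[OF S]]
    by (intro arg_cong[where f="fscale (1/4)"] sum.cong refl) (simp add: number)
  also have "\<dots> = fscale (\<Sum>i<n. 1/4 * (H $$ (i,i) * (if i \<in> S then -2 else 2))) (bvec n S)"
    by (simp only: fs.scale_scale fs.scale_sum_left[symmetric] sum_distrib_left)
  also have "(\<Sum>i<n. 1/4 * (H $$ (i,i) * (if i \<in> S then -2 else 2))) = wt n (sc_diagram n S) H"
    unfolding wt_sc_diagram[OF S] by (rule sum.cong) auto
  finally show ?thesis .
qed

lemma chev_h_cartan:
  assumes k: "k \<in> {1..n}"
  shows "chev_h n k \<in> cartan n"
proof -
  have le: "k-1 \<le> 2*n" "k \<le> 2*n" "2*n-(k-1) = 2*n-k+1" using k by auto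
  have "chev_h n k = (if k = n then 2 else 1) \<cdot>\<^sub>m (root_mat n (k-1) (k-1) + (-1) \<cdot>\<^sub>m root_mat n k k)"
    unfolding chev_h_def root_mat_def le(3)
    by (rule eq_matI) (simp_all add: algebra_simps del: elem_mat_entry)
  also have "\<dots> \<in> cartan n"
  proof (rule cartanI)
    show "(if k = n then 2 else 1) \<cdot>\<^sub>m (root_mat n (k-1) (k-1) + (-1) \<cdot>\<^sub>m root_mat n k k) \<in> so_odd n"
      by (intro smult_in_so_odd add_in_so_odd root_mat_in_so_odd le)
  next
    fix a b assume ab: "a \<le> 2*n" "b \<le> 2*n" "a \<noteq> b"
    have "root_mat n (k-1) (k-1) $$ (a,b) = 0" "root_mat n k k $$ (a,b) = 0"
      by (rule cartan_off_diagonal[OF root_mat_diag_cartan[OF le(1)] ab],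
          rule cartan_off_diagonal[OF root_mat_diag_cartan[OF le(2)] ab])
    then have "(c \<cdot>\<^sub>m (root_mat n (k-1) (k-1) + (-1) \<cdot>\<^sub>m root_mat n k k)) $$ (a,b) = 0" for c
      using ab by simp
    then show "((if k = n then 2 else 1) \<cdot>\<^sub>m
        (root_mat n (k-1) (k-1) + (-1) \<cdot>\<^sub>m root_mat n k k)) $$ (a,b) = 0" .
  qed
  finally show ?thesis .
qed

lemma spin_rep_eqI:
  assumes X: "X \<in> so_odd n" and v: "v \<in> sc_space n"
    and basis: "\<And>S. S \<subseteq> {..<n} \<Longrightarrow> spin_rep n X (bvec n S) = h (sc_diagram n S)"
  shows "spin_rep n X v = lin_ext h v"
  using v
proof (induction rule: sc_space_induct)
  case (basis S)
  then show ?case using assms(3)[of S] by (simp add: bvec_def)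
qed (simp_all add: spin_rep.act_add[OF X] spin_rep.act_scale[OF X] lin_ext_add lin_ext_scale)

lemma spin_rep_chevalley:
  assumes k: "k \<in> {1..n}" and v: "v \<in> sc_space n"
  shows "spin_rep n (chev_e n k) v = op_e n k v"
    and "spin_rep n (chev_f n k) v = op_f n k v"
    and "spin_rep n (chev_h n k) v = op_h n k v"
proof -
  have kn: "1 \<le> k" "k \<le> n" using k by auto
  show "spin_rep n (chev_e n k) v = op_e n k v"
    unfolding op_e_def using chev_in_so_odd[OF k] v
    by (intro spin_rep_eqI) (simp_all add: spin_rep_chev_e_bvec[OF k] e_tilde_sc_diagram[OF kn] vec_of_def flip: bvec_def)
  show "spin_rep n (chev_f n k) v = op_f n k v"
    unfolding op_f_def using chev_in_so_odd[OF k] v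
    by (intro spin_rep_eqI) (simp_all add: spin_rep_chev_f_bvec[OF k] f_tilde_sc_diagram[OF kn] vec_of_def flip: bvec_def)
  show "spin_rep n (chev_h n k) v = op_h n k v"
    unfolding op_h_def using cartan_so_odd[OF chev_h_cartan[OF k]] v
    by (intro spin_rep_eqI) (simp_all add: spin_rep_cartan_bvec[OF chev_h_cartan[OF k]] flip: bvec_def)
qed

section \<open>Irreducibility\<close>

text \<open>The root vectors for the short roots \<open>\<plusminus>\<epsilon>\<^bsub>i+1\<^esub>\<close>, in the middle row or column, act as a product of a
  Clifford generator with the diagonal middle one, so they remove or insert a single element.\<close>

lemma bvec_toggle_in_invariant:
  assumes U: "invariant_subspace n fscale (sc_space n) (spin_rep n) U"
    and S: "S \<subseteq> {..<n}" "bvec n S \<in> U" and i: "i < n"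
  shows "bvec n (toggle n i S) \<in> U"
proof -
  have m: "i = min i (2*n-i)" "n = min n (2*n-n)" using i by auto
  have le: "i \<le> 2*n" "n \<le> 2*n" "i \<noteq> n" "n \<noteq> i" using i by auto
  have jw_sign_nonzero: "jw_sign j A \<noteq> 0" for j A by (simp add: jw_sign_def)
  have tn: "toggle n n A = A" for A by (simp add: toggle_def)
  obtain X c where X: "X \<in> so_odd n" "spin_rep n X (bvec n S) = fscale c (bvec n (toggle n i S))" "c \<noteq> 0"
  proof (cases "i \<in> S")
    case True
    have "spin_rep n (root_mat n i n) (bvec n S) = fscale (jw_sign n S * jw_sign i S) (bvec n (toggle n i S))"
      unfolding spin_rep_root_mat_bvec[OF S(1) le(1,2,3) m] tn
      using True i by (simp add: spin_factor_def)
    then show thesis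
      using jw_sign_nonzero root_mat_in_so_odd[OF le(1,2)]
      by (intro that[of "root_mat n i n" "jw_sign n S * jw_sign i S"]) auto
  next
    case False
    have b: "\<not> 2*n-i < n" "2*n-i \<noteq> n" "2*n-(2*n-i) = i" using i by auto
    have "spin_rep n (root_mat n n i) (bvec n S)
        = fscale (1/2 * (jw_sign i S * jw_sign n (toggle n i S))) (bvec n (toggle n i S))"
      unfolding spin_rep_root_mat_bvec[OF S(1) le(2,1,4) m(2,1)] tn
      using False i b by (simp add: spin_factor_def)
    then show thesis
      using jw_sign_nonzero root_mat_in_so_odd[OF le(2,1)]
      by (intro that[of "root_mat n n i" "1/2 * (jw_sign i S * jw_sign n (toggle n i S))"]) auto
  qed
  have subU: "fs.subspace U" using U by (simp add: invariant_subspace_def)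
  have "spin_rep n X (bvec n S) \<in> U"
    using U X(1) S(2) by (auto simp: invariant_subspace_def)
  then have "fscale c (bvec n (toggle n i S)) \<in> U" by (simp add: X(2))
  then have "fscale (1/c) (fscale c (bvec n (toggle n i S))) \<in> U"
    by (rule fs.subspace_scale[OF subU])
  moreover have "fscale (1/c) (fscale c (bvec n (toggle n i S))) = bvec n (toggle n i S)"
    using X(3) by simp
  ultimately show ?thesis by simp
qed

lemma invariant_eq_sc_space:
  assumes U: "invariant_subspace n fscale (sc_space n) (spin_rep n) U"
    and S: "S \<subseteq> {..<n}" "bvec n S \<in> U"
  shows "U = sc_space n"
proof -
  have subU: "fs.subspace U" and UV: "U \<subseteq> sc_space n" using U by (auto simp: invariant_subspace_def)
  have sym_diff: "bvec n (sym_diff S D) \<in> U" if "D \<subseteq> {..<n}" for D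
  proof -
    have "finite D" using that finite_subset by blast
    then show ?thesis using that
    proof (induction D rule: finite_induct)
      case (insert i D)
      have "sym_diff S (insert i D) = toggle n i (sym_diff S D)"
        using insert by (auto simp: toggle_def)
      moreover have "sym_diff S D \<subseteq> {..<n}" using S(1) insert.prems by auto
      ultimately show ?case
        using bvec_toggle_in_invariant[OF U, of "sym_diff S D" i] insert by auto
    qed (use S in simp)
  qed
  have "bvec n T \<in> U" if "T \<subseteq> {..<n}" for T
  proof -
    have "sym_diff S (sym_diff S T) = T" by auto
    then show ?thesis using sym_diff[of "sym_diff S T"] S(1) that by auto
  qed
  then have "sc_space n \<subseteq> U"
    unfolding sc_space_eq by (intro fs.span_minimal subU) auto
  then show ?thesis using UV by blast
qed

text \<open>An element of the Cartan subalgebra on which the weights of all diagrams differ, by uniqueness of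
  binary expansions.\<close>

definition binary_mat :: "nat \<Rightarrow> complex mat" where
  "binary_mat n = mat (2*n+1) (2*n+1)
     (\<lambda>(i,j). if i \<noteq> j \<or> i = n then 0 else if i < n then 2 ^ i else - (2 ^ (2*n-i)))"

lemma binary_mat_cartan: "binary_mat n \<in> cartan n"
proof (rule cartanI)
  have "binary_mat n $$ (2*n-j, 2*n-i) = - binary_mat n $$ (i, j)" if ij: "i \<le> 2*n" "j \<le> 2*n" for i j
  proof (cases "i = j")
    case True
    consider "i < n" "\<not> 2*n-i < n" "2*n-i \<noteq> n" | "i = n" "2*n-i = n" | "n < i" "2*n-i < n"
      using ij by linarith
    then show ?thesis using True ij by cases (auto simp: binary_mat_def)
  next
    case False
    then have "2*n-j \<noteq> 2*n-i" using ij by linarith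
    then show ?thesis using False ij by (simp add: binary_mat_def)
  qed
  then show "binary_mat n \<in> so_odd n"
    by (auto simp: in_so_odd_iff binary_mat_def)
qed (auto simp: binary_mat_def)

lemma inj_on_wt_binary_mat: "inj_on (\<lambda>S. wt n (sc_diagram n S) (binary_mat n)) (Pow {..<n})"
proof (rule inj_onI)
  have w: "wt n (sc_diagram n S) (binary_mat n) = (\<Sum>i<n. 2^i) / 2 - of_nat (set_encode S)"
    if S: "S \<subseteq> {..<n}" for S
  proof -
    have "wt n (sc_diagram n S) (binary_mat n) = (\<Sum>i<n. 2^i / 2 - (if i \<in> S then 2^i else 0))"
      unfolding wt_sc_diagram[OF S] by (rule sum.cong) (auto simp: binary_mat_def)
    also have "\<dots> = (\<Sum>i<n. 2^i) / 2 - (\<Sum>i\<in>S. 2^i)"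
      using S by (simp add: sum_subtractf sum_divide_distrib sum.If_cases Int_absorb1)
    finally show ?thesis by (simp add: set_encode_def)
  qed
  fix S T assume "S \<in> Pow {..<n}" "T \<in> Pow {..<n}"
    and eq: "wt n (sc_diagram n S) (binary_mat n) = wt n (sc_diagram n T) (binary_mat n)"
  then have ST: "S \<subseteq> {..<n}" "T \<subseteq> {..<n}" by auto
  then have "finite S" "finite T" by (auto intro: finite_subset)
  moreover have "set_encode S = set_encode T" using eq ST by (simp add: w)
  ultimately show "S = T" using inj_on_set_encode by (auto simp: inj_on_def)
qed

lemma sc_space_expansion:
  assumes "v \<in> sc_space n"
  obtains c where "v = (\<Sum>S\<in>Pow {..<n}. fscale (c S) (bvec n S))"
proof -
  have "\<exists>c. v = (\<Sum>S\<in>Pow {..<n}. fscale (c S) (bvec n S))"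
    using assms
  proof (induction rule: sc_space_induct)
    case (basis S)
    have "(\<Sum>T\<in>Pow {..<n}. fscale (if T = S then 1 else 0) (bvec n T))
        = (\<Sum>T\<in>Pow {..<n}. if T = S then bvec n T else 0)"
      by (rule sum.cong) auto
    also have "\<dots> = bvec n S" using basis by simp
    finally show ?case by (intro exI[of _ "\<lambda>T. if T = S then 1 else 0"]) simp
  next
    case (add x y)
    then obtain c d where "x = (\<Sum>S\<in>Pow {..<n}. fscale (c S) (bvec n S))"
      "y = (\<Sum>S\<in>Pow {..<n}. fscale (d S) (bvec n S))" by blast
    then show ?case
      by (intro exI[of _ "\<lambda>S. c S + d S"]) (simp add: fs.scale_left_distrib sum.distrib)
  next
    case (scale a x)
    then obtain c where "x = (\<Sum>S\<in>Pow {..<n}. fscale (c S) (bvec n S))" by blast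
    then show ?case
      by (intro exI[of _ "\<lambda>S. a * c S"]) (simp add: fs.scale_sum_right)
  qed
  then show thesis using that by blast
qed

text \<open>The weights are distinct, so an invariant subspace contains the weight components of its elements.
  If it is nonzero it therefore contains a basis vector, and then everything.\<close>

lemma irreducible_spin_rep: "irreducible_rep n fscale (sc_space n) (spin_rep n)"
  unfolding irreducible_rep_def
proof (intro conjI allI impI)
  show "so_rep n fscale (sc_space n) (spin_rep n)" by (rule so_rep_spin_rep)
  show "sc_space n \<noteq> {0}" using bvec_in[of "{}" n] bvec_nonzero[of n "{}"] by blast
  fix U assume U: "invariant_subspace n fscale (sc_space n) (spin_rep n) U"
  then have subU: "fs.subspace U" and UV: "U \<subseteq> sc_space n" by (auto simp: invariant_subspace_def)
  show "U = {0} \<or> U = sc_space n"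
  proof (rule disjCI)
    assume "U \<noteq> sc_space n"
    then have none: "bvec n S \<notin> U" if "S \<subseteq> {..<n}" for S
      using invariant_eq_sc_space[OF U that] by blast
    have "u = 0" if u: "u \<in> U" for u
    proof -
      obtain c where c: "u = (\<Sum>S\<in>Pow {..<n}. fscale (c S) (bvec n S))"
        using u UV sc_space_expansion by blast
      note B = cartan_so_odd[OF binary_mat_cartan, of n]
      have "fscale (c S) (bvec n S) \<in> U" if "S \<in> Pow {..<n}" for S
      proof (rule spin_rep.eigenvector_components[OF B subU _ _ inj_on_wt_binary_mat _ _ _ that])
        show "spin_rep n (binary_mat n) w \<in> U" if "w \<in> U" for w
          using that U B by (auto simp: invariant_subspace_def)
        show "(\<Sum>S\<in>Pow {..<n}. fscale (c S) (bvec n S)) \<in> U" using u c by simp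
        fix T assume T: "T \<in> Pow {..<n}"
        then show "fscale (c T) (bvec n T) \<in> sc_space n"
          by (intro fs.subspace_scale subspace_sc_space) auto
        show "spin_rep n (binary_mat n) (fscale (c T) (bvec n T))
            = fscale (wt n (sc_diagram n T) (binary_mat n)) (fscale (c T) (bvec n T))"
          using T spin_rep.act_scale[OF B] spin_rep_cartan_bvec[OF binary_mat_cartan]
          by (simp add: mult.commute)
      qed simp
      moreover have "bvec n S = fscale (1 / c S) (fscale (c S) (bvec n S))" if "c S \<noteq> 0" for S
        using that by simp
      ultimately have "c S = 0" if "S \<in> Pow {..<n}" for S
        using none[of S] that fs.subspace_scale[OF subU] by (metis PowD)
      then show ?thesis unfolding c by simp
    qed
    then show "U = {0}" using fs.subspace_0[OF subU] by auto
  qed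
qed

lemma spin_rep_is_irreducible_hw_rep:
  "is_irreducible_hw_rep n (fund_weight n n) fscale (sc_space n) (spin_rep n)"
  unfolding is_irreducible_hw_rep_def highest_weight_rep_def
proof (intro conjI irreducible_spin_rep so_rep_spin_rep bexI[of _ "bvec n {}"] ballI allI impI)
  show "bvec n {} \<noteq> 0" by (rule bvec_nonzero)
  show "spin_rep n (chev_e n k) (bvec n {}) = 0" if "k \<in> {1..n}" for k
    using spin_rep_chev_e_bvec[OF that, of "{}"] by simp
  show "spin_rep n H (bvec n {}) = fscale (fund_weight n n H) (bvec n {})" if "H \<in> cartan n" for H
  proof -
    have "sc_diagram n {} = {}" by (auto simp: sc_diagram_def below_def)
    then show ?thesis using spin_rep_cartan_bvec[OF that, of "{}"] by (simp add: wt_def)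
  qed
  show "U = sc_space n"
    if "invariant_subspace n fscale (sc_space n) (spin_rep n) U \<and> bvec n {} \<in> U" for U
    using that invariant_eq_sc_space[of n U "{}"] by simp
qed simp

theorem proposition9p4:
  fixes n :: nat
  assumes "n \<ge> 1"
  shows "\<exists>\<rho>. so_rep n fscale (sc_space n) \<rho> \<and>
    (\<forall>k\<in>{1..n}. \<forall>v\<in>sc_space n.
       \<rho> (chev_e n k) v = op_e n k v \<and>
       \<rho> (chev_f n k) v = op_f n k v \<and>
       \<rho> (chev_h n k) v = op_h n k v) \<and>
    is_irreducible_hw_rep n (fund_weight n n) fscale (sc_space n) \<rho> \<and>
    (\<forall>(scl :: complex \<Rightarrow> 'w::ab_group_add \<Rightarrow> 'w) W \<sigma>.
       is_irreducible_hw_rep n (fund_weight n n) scl W \<sigma> \<longrightarrow>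
       rep_isomorphic n fscale (sc_space n) \<rho> scl W \<sigma>)"
  using so_rep_spin_rep spin_rep_chevalley spin_rep_is_irreducible_hw_rep
    irreducible_hw_rep_unique[OF spin_rep_is_irreducible_hw_rep]
  by (intro exI[of _ "spin_rep n"] conjI ballI allI impI) simp_all

end
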